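(* Let the difference equation, the numbers $\rho_i,e_i,k_i$, the integer $m$, the solution space $V_m$ and the subspaces $V_{m,i}^\vee$, $V_{m,i}^\wedge$ ($1\le i\le s+1$) be as described in the context. Let $\theta\in\{1,\ldots,s\}$ and let $V$ be an arbitrary linear subspace of $V_m$ such that $$V\cap V_{m,\theta+1}^\wedge=\{0\}.$$ Put $k=\max(k_1,\ldots,k_s)$. Then there exists a constant $A^\ast=A^\ast(V)>0$ such that $$\exp\bigl(-A^\ast(\ln(\nu)+\nu^{1-1/k})\bigr)\,(\rho_\theta)^{\nu}\,\omega_{n,y}(m)\le\omega_{n,y}(\nu)$$ for all $y\in V$ and all integers $\nu\ge m$.
   Context: Notation: $\mathbb N=\{1,2,3,\ldots\}$. Setting: let $s\ge 0$ be an integer, $n\in\mathbb N$, $a_i^\sim\in\mathbb C$ and $a_i(\nu)\in\mathbb C$ for $i=0,\ldots,n$ and integers $\nu\ge 0$, with $a_n(\nu)=1$ for all $\nu\ge0$ and $a_i(\nu)-a_i^\sim=O(1/(\nu+1))$ for $i=0,\ldots,n$ (so $a_n^\sim=1$). For $m\in\mathbb N$, $V_m$ denotes the $\mathbb C$-linear space of solutions $y=(y(\nu))_{\nu\ge m}$, $y(\nu)\in\mathbb C$, of $$\sum_{k=0}^n a_k(\nu)y(\nu+k)=0,\qquad \nu\ge m.$$ Let $T(z)=\sum_{k=0}^n a_k^\sim z^k$ be the characteristic polynomial. The absolute values of all roots of $T$ are assumed to be among the real numbers $\rho_1>\rho_2>\cdots>\rho_s>\rho_{s+1}=0$. For $i=1,\ldots,s+1$,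 $e_i$ and $k_i$ denote respectively the sum and the maximum of the multiplicities of those roots of $T$ whose absolute value equals $\rho_i$ (both $0$ if there are none); put $k^\ast=k_{s+1}$. It is assumed that $e_i>0$ for $i=1,\ldots,s$. For a sequence $y=(y(\nu))_{\nu\ge m}$ put $$\omega_{n,y}(\nu)=\max(|y(\nu)|,\ldots,|y(\nu+n-1)|).$$ Fix data as provided by the following previously known theorem: there exist $A>0$, $m\in\mathbb N$, numbers $\alpha(\nu)>0$ ($\nu\ge m$) with $\alpha(\nu)\to0$ as $\nu\to\infty$, and subspaces $V_{m,1}^\vee,\ldots,V_{m,s+1}^\vee$ of $V_m$ such that $V_m=V_{m,1}^\vee\oplus\cdots\oplus V_{m,s+1}^\vee$, $\dim_{\mathbb C}V_{m,i}^\vee=e_i$, and, with $$V_{m,j}^\wedge=V_{m,j}^\vee\oplus\cdots\oplus V_{m,s+1}^\vee\quad(1\le j\le s+1)$$ and $\pi_j:V_{m,j}^\wedge\to V_{m,j}^\vee$ ($1\le j\le s$) the natural projection (with kernel $V_{m,j+1}^\wedge$), the following hold for all $\nu\ge m$: (1) if $y\in V_{m,\theta}^\vee$ with $1\le\theta\le s$, then $\exp(-A(\ln\nu+\nu^{1-1/k_\theta}))\rho_\theta^\nu\,\omega_{n,y}(m)\le\omega_{n,y}(\nu)$; (2) if $y\in V_{m,\theta}^\wedge$ with $1\le\theta\le s$, then $\omega_{n,y}(\nu)\le\exp(A(\ln\nu+\nu^{1-1/k_\theta}))\rho_\theta^\nu\,\omega_{n,y}(m)$ and $(\omega_{n,\pi_\theta(y)}(m)-\alpha(\nu)\omega_{n,y}(m))\rho_\theta^\nu\exp(-A(\ln\nu+\nu^{1-1/k_\theta}))\le\omega_{n,y}(\nu)$;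 (3) if $k^\ast>0$ and $y\in V_{m,s+1}^\vee=V_{m,s+1}^\wedge$, then $|y(\nu)|\le(A/\nu)^{\nu/k^\ast}\omega_{n,y}(m)$. The spaces $V_{m,j}^\wedge$ do not depend on the choice of such a decomposition: $V_{m,j}^\wedge=\{y\in V_m:\limsup_{\nu\to\infty}|y(\nu)|^{1/\nu}\le\rho_j\}$. *)

theory Defs
  imports
    Complex_Main
    "HOL-Library.Function_Algebras"
    "HOL-Library.Landau_Symbols"
    "HOL-Computational_Algebra.Polynomial"
begin

definition seq_scale :: "complex \<Rightarrow> (nat \<Rightarrow> complex) \<Rightarrow> nat \<Rightarrow> complex" where
  "seq_scale c y = (\<lambda>\<nu>. c * y \<nu>)"

global_interpretation seq: vector_space seq_scale
  by unfold_locales (simp_all add: seq_scale_def fun_eq_iff algebra_simps)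

definition characteristic_polynomial :: "nat \<Rightarrow> (nat \<Rightarrow> complex) \<Rightarrow> complex poly" where
  "characteristic_polynomial n c = (\<Sum>k\<le>n. monom (c k) k)"

definition roots_of_modulus :: "complex poly \<Rightarrow> real \<Rightarrow> complex set" where
  "roots_of_modulus p r = {z. poly p z = 0 \<and> cmod z = r}"

definition multiplicity_sum :: "complex poly \<Rightarrow> real \<Rightarrow> nat" where
  "multiplicity_sum p r = (\<Sum>z\<in>roots_of_modulus p r. order z p)"

definition multiplicity_max :: "complex poly \<Rightarrow> real \<Rightarrow> nat" where
  "multiplicity_max p r = Max (insert 0 ((\<lambda>z. order z p) ` roots_of_modulus p r))"

(* A sequence indexed by \<nu> \<ge> m is encoded as a function on nat that vanishes below m; without this
   normalization the dimension would count the irrelevant values y 0, ..., y (m - 1). *)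
definition solution_space :: "nat \<Rightarrow> (nat \<Rightarrow> nat \<Rightarrow> complex) \<Rightarrow> nat \<Rightarrow> (nat \<Rightarrow> complex) set" where
  "solution_space n a m =
     {y. (\<forall>\<nu><m. y \<nu> = 0) \<and> (\<forall>\<nu>\<ge>m. (\<Sum>k\<le>n. a k \<nu> * y (\<nu> + k)) = 0)}"

definition omega :: "nat \<Rightarrow> (nat \<Rightarrow> complex) \<Rightarrow> nat \<Rightarrow> real" where
  "omega n y \<nu> = Max ((\<lambda>i. cmod (y (\<nu> + i))) ` {..<n})"

definition sum_of_spaces :: "'i set \<Rightarrow> ('i \<Rightarrow> (nat \<Rightarrow> complex) set) \<Rightarrow> (nat \<Rightarrow> complex) set" where
  "sum_of_spaces I W = {\<Sum>i\<in>I. f i | f. \<forall>i\<in>I. f i \<in> W i}"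

definition is_direct_sum ::
  "(nat \<Rightarrow> complex) set \<Rightarrow> 'i set \<Rightarrow> ('i \<Rightarrow> (nat \<Rightarrow> complex) set) \<Rightarrow> bool" where
  "is_direct_sum U I W \<longleftrightarrow>
     (\<forall>i\<in>I. seq.subspace (W i)) \<and> U = sum_of_spaces I W \<and>
     (\<forall>f. (\<forall>i\<in>I. f i \<in> W i) \<and> (\<Sum>i\<in>I. f i) = 0 \<longrightarrow> (\<forall>i\<in>I. f i = 0))"

(* W i stands for the i-th summand (written with a check accent), and tail_space s W j for the sum of
   the summands j, ..., s + 1 (written with a hat). *)
definition tail_space ::
  "nat \<Rightarrow> (nat \<Rightarrow> (nat \<Rightarrow> complex) set) \<Rightarrow> nat \<Rightarrow> (nat \<Rightarrow> complex) set" where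
  "tail_space s W j = sum_of_spaces {j..s+1} W"

(* The projection of tail_space s W j onto W j with kernel tail_space s W (j + 1); it is only
   meaningful when the sum is direct and y lies in tail_space s W j. *)
definition tail_projection ::
  "nat \<Rightarrow> (nat \<Rightarrow> (nat \<Rightarrow> complex) set) \<Rightarrow> nat \<Rightarrow> (nat \<Rightarrow> complex) \<Rightarrow> nat \<Rightarrow> complex" where
  "tail_projection s W j y = (THE z. z \<in> W j \<and> y - z \<in> tail_space s W (j + 1))"

definition growth_exponent :: "nat \<Rightarrow> nat \<Rightarrow> real" where
  "growth_exponent k \<nu> = ln (real \<nu>) + real \<nu> powr (1 - 1 / real k)"

end

theory Submission
  imports Defs
begin

text \<open>
  Split a solution \<open>y \<in> V\<close> along the direct sum as \<open>y = w\<^sub>1 + \<dots> + w\<^sub>\<theta> + t\<close>, where \<open>w\<^sub>j \<in> W j\<close> and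
  \<open>t\<close> lies in the tail space of index \<open>\<theta> + 1\<close>. As \<open>V\<close> meets that tail space trivially, the values
  of \<open>w\<^sub>1, \<dots>, w\<^sub>\<theta>\<close> at the places \<open>m, \<dots>, m + n - 1\<close> separate the points of \<open>V\<close>; finitely many
  separating functionals control every seminorm (\<open>seminorm_le_separating_functionals\<close>), so the
  initial size of \<open>t\<close>, and hence that of \<open>y\<close>, is at most a constant times
  \<open>Q = |w\<^sub>1| + \<dots> + |w\<^sub>\<theta>|\<close>, with \<open>|w|\<close> short for \<open>omega n w m\<close>. The tail \<open>t\<close> grows at a rate
  below \<open>\<rho> \<theta>\<close>, so everything reduces to showing that \<open>w\<^sub>1 + \<dots> + w\<^sub>\<theta>\<close> is at least
  \<open>\<rho> \<theta> ^ \<nu> Q\<close> up to a factor \<open>exp (B * growth_exponent k \<nu>)\<close>.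

  Each \<open>w\<^sub>j\<close> is known to have size \<open>\<rho> j ^ \<nu> |w\<^sub>j|\<close> up to such a factor; the difficulty is
  cancellation between components of different rates, which may well be of comparable size
  at some particular \<open>\<nu>\<close>. Here the recurrence itself helps. Within \<open>d\<close> further steps the slower
  component falls behind the faster one by the factor \<open>(\<sigma> / \<tau>) ^ d\<close>, with \<open>\<sigma> < \<tau>\<close> the two rates.
  Since the accumulated error factors are only \<open>exp (O (growth_exponent k \<nu>))\<close>, a look-ahead of
  \<open>d = O (growth_exponent k \<nu>)\<close> steps suffices for the faster component to dominate at \<open>\<nu> + d\<close>. In the
  other direction, a solution grows at most by a constant factor \<open>C\<close> per step, so the lower
  bound at \<open>\<nu> + d\<close> is transported back to \<open>\<nu>\<close> at the price of \<open>C ^ d\<close>, which is again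
  \<open>exp (O (growth_exponent k \<nu>))\<close>. This is \<open>superposition_of_rates\<close>, a statement about real sequences;
  induction over the components gives \<open>component_sum_lower_bound\<close>.

  All this yields the bound for large \<open>\<nu>\<close>; the crude growth of solutions extends it to every
  \<open>\<nu> \<ge> m\<close> (\<open>lower_bound_from_eventual\<close>).
\<close>

section \<open>The subexponential growth scale\<close>

lemma growth_exponent_ge_1:
  assumes "k \<ge> 1" "\<nu> \<ge> 1"
  shows "growth_exponent k \<nu> \<ge> 1"
proof -
  have "real \<nu> powr (1 - 1 / real k) \<ge> 1"
    using assms by (intro ge_one_powr_ge_zero) (auto simp: field_simps)
  moreover have "ln (real \<nu>) \<ge> 0" using assms by simp
  ultimately show ?thesis unfolding growth_exponent_def by linarith
qed

lemma growth_exponent_mono: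
  assumes "k \<ge> 1" "\<nu> \<ge> 1" "\<nu> \<le> \<mu>"
  shows "growth_exponent k \<nu> \<le> growth_exponent k \<mu>"
  unfolding growth_exponent_def
  using assms by (intro add_mono powr_mono2) (auto simp: field_simps)

text \<open>
  This replaces the exponents of the individual components by the single one belonging to the
  largest multiplicity.
\<close>

lemma growth_exponent_mono_index:
  assumes "1 \<le> j" "j \<le> k" "\<nu> \<ge> 1"
  shows "growth_exponent j \<nu> \<le> growth_exponent k \<nu>"
  unfolding growth_exponent_def
  using assms by (intro add_mono powr_mono) (auto simp: field_simps)

lemma growth_exponent_double:
  assumes "k \<ge> 1" "\<nu> \<ge> 2"
  shows "growth_exponent k (2 * \<nu>) \<le> 2 * growth_exponent k \<nu>"
proof -
  have "real (2 * \<nu>) powr (1 - 1 / real k) = 2 powr (1 - 1 / real k) * real \<nu> powr (1 - 1 / real k)"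
    by (simp add: powr_mult)
  also have "\<dots> \<le> 2 powr 1 * real \<nu> powr (1 - 1 / real k)"
    by (intro mult_right_mono powr_mono) auto
  finally have "real (2 * \<nu>) powr (1 - 1 / real k) \<le> 2 * real \<nu> powr (1 - 1 / real k)" by simp
  moreover have "ln (real (2 * \<nu>)) \<le> 2 * ln (real \<nu>)"
    using assms by (simp add: ln_mult)
  ultimately show ?thesis unfolding growth_exponent_def by simp
qed

lemma growth_exponent_sublinear:
  assumes "k \<ge> 1" and "\<epsilon> > 0"
  shows "\<forall>\<^sub>F \<nu> in sequentially. growth_exponent k \<nu> \<le> \<epsilon> * real \<nu>"
proof -
  have "((\<lambda>x::real. ln x / x + x powr (- 1 / real k)) \<longlongrightarrow> 0 + 0) at_top"
    using assms by (intro tendsto_add ln_x_over_x_tendsto_0 tendsto_neg_powr filterlim_ident) auto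
  then have "((\<lambda>\<nu>. ln (real \<nu>) / real \<nu> + real \<nu> powr (- 1 / real k)) \<longlongrightarrow> 0) sequentially"
    using filterlim_compose[OF _ filterlim_real_sequentially] by fastforce
  from order_tendstoD(2)[OF this \<open>\<epsilon> > 0\<close>] eventually_gt_at_top[of "0::nat"]
  show ?thesis
  proof eventually_elim
    case (elim \<nu>)
    have "growth_exponent k \<nu> = (ln (real \<nu>) / real \<nu> + real \<nu> powr (- 1 / real k)) * real \<nu>"
      using elim by (simp add: growth_exponent_def field_simps powr_diff powr_minus)
    also have "\<dots> \<le> \<epsilon> * real \<nu>" using elim by (intro mult_right_mono) auto
    finally show ?case .
  qed
qed

text \<open>
  As the growth exponent is sublinear, any strict gap between two rates eventually absorbs a
  subexponential factor.
\<close>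

lemma power_ratio_beats_growth_exponent:
  assumes "k \<ge> 1" and "K \<ge> 0" and "0 < \<sigma>" and "\<sigma> < \<tau>"
  shows "\<forall>\<^sub>F \<nu> in sequentially. exp (K * growth_exponent k \<nu>) * \<sigma> ^ \<nu> \<le> \<tau> ^ \<nu>"
proof -
  define l where "l = ln (\<tau> / \<sigma>)"
  have l: "l > 0" using assms by (simp add: l_def)
  have "\<forall>\<^sub>F \<nu> in sequentially. growth_exponent k \<nu> \<le> l / (K + 1) * real \<nu>"
    using assms l by (intro growth_exponent_sublinear) auto
  moreover have "\<forall>\<^sub>F \<nu> in sequentially. \<nu> \<ge> (1::nat)" by (rule eventually_ge_at_top)
  ultimately show ?thesis
  proof eventually_elim
    case (elim \<nu>)
    have g: "growth_exponent k \<nu> \<ge> 1" using growth_exponent_ge_1 assms elim by blast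
    have "K * growth_exponent k \<nu> \<le> (K + 1) * growth_exponent k \<nu>" using g by (simp add: algebra_simps)
    also have "\<dots> \<le> (K + 1) * (l / (K + 1) * real \<nu>)"
      using elim assms by (intro mult_left_mono) auto
    also have "\<dots> = real \<nu> * l" using assms by simp
    finally have "exp (K * growth_exponent k \<nu>) \<le> exp (real \<nu> * l)" by simp
    also have "\<dots> = (\<tau> / \<sigma>) ^ \<nu>" using assms by (simp add: exp_of_nat_mult l_def)
    finally show ?case using assms by (simp add: power_divide field_simps)
  qed
qed

text \<open>
  The number \<open>d\<close> of steps has to beat an exponent that is itself evaluated at \<open>\<nu> + d\<close>. This is not
  circular: eventually \<open>d \<le> \<nu>\<close>, because \<open>growth_exponent k \<nu> = o(\<nu>)\<close>, and doubling the argument at most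
  doubles the growth exponent. It is essential that \<open>d\<close> is bounded by a multiple of
  \<open>growth_exponent k \<nu>\<close>, since later an exponential in \<open>d\<close> is lost.
\<close>

lemma look_ahead:
  assumes "k \<ge> 1" and "q > 1" and "K \<ge> 0"
  obtains L where "L \<ge> 0" and "\<forall>\<^sub>F \<nu> in sequentially. \<exists>d. real d \<le> L * growth_exponent k \<nu> \<and>
    growth_exponent k (\<nu> + d) \<le> 2 * growth_exponent k \<nu> \<and>
    exp (K * growth_exponent k (\<nu> + d)) \<le> q ^ d"
proof
  define L where "L = 2 * K / ln q + 1"
  have lnq: "ln q > 0" using assms by simp
  show L: "L \<ge> 0" using assms lnq by (simp add: L_def)
  have "\<forall>\<^sub>F \<nu> in sequentially. growth_exponent k \<nu> \<le> 1 / (L + 1) * real \<nu>"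
    using assms L by (intro growth_exponent_sublinear) auto
  moreover have "\<forall>\<^sub>F \<nu> in sequentially. \<nu> \<ge> (2::nat)" by (rule eventually_ge_at_top)
  ultimately show "\<forall>\<^sub>F \<nu> in sequentially. \<exists>d. real d \<le> L * growth_exponent k \<nu> \<and>
    growth_exponent k (\<nu> + d) \<le> 2 * growth_exponent k \<nu> \<and>
    exp (K * growth_exponent k (\<nu> + d)) \<le> q ^ d"
  proof eventually_elim
    case (elim \<nu>)
    define g where "g = growth_exponent k \<nu>"
    have g: "g \<ge> 1" using growth_exponent_ge_1[of k \<nu>] assms elim by (simp add: g_def)
    define d where "d = nat \<lceil>2 * K / ln q * g\<rceil>"
    have nonneg: "0 \<le> 2 * K / ln q * g" using assms lnq g by simp
    have d_ge: "2 * K / ln q * g \<le> real d" unfolding d_def by linarith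
    have "real d \<le> 2 * K / ln q * g + 1" using nonneg unfolding d_def by linarith
    then have d_le: "real d \<le> L * g" using g by (simp add: L_def algebra_simps)
    have "L * g \<le> (L + 1) * g" using g by (simp add: algebra_simps)
    also have "\<dots> \<le> (L + 1) * (1 / (L + 1) * real \<nu>)"
      using elim L unfolding g_def by (intro mult_left_mono) auto
    also have "\<dots> = real \<nu>" using L by simp
    finally have "d \<le> \<nu>" using d_le by linarith
    then have "growth_exponent k (\<nu> + d) \<le> growth_exponent k (2 * \<nu>)"
      using assms elim by (intro growth_exponent_mono) auto
    then have gd: "growth_exponent k (\<nu> + d) \<le> 2 * g"
      using growth_exponent_double[of k \<nu>] assms elim by (simp add: g_def)
    have "K * growth_exponent k (\<nu> + d) \<le> K * (2 * g)"
      using gd assms by (intro mult_left_mono) auto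
    also have "\<dots> = 2 * K / ln q * g * ln q" using lnq by simp
    also have "\<dots> \<le> real d * ln q" using d_ge lnq by (intro mult_right_mono) auto
    finally have "exp (K * growth_exponent k (\<nu> + d)) \<le> exp (real d * ln q)" by simp
    also have "\<dots> = q ^ d" using assms by (simp add: exp_of_nat_mult)
    finally show ?case using d_le gd by (auto simp: g_def)
  qed
qed

section \<open>Superposition of a faster and a slower rate\<close>

lemma iterate_crude_growth:
  fixes S :: "nat \<Rightarrow> real"
  assumes "C \<ge> 0" and "\<And>\<nu>. \<nu> \<ge> m \<Longrightarrow> S (Suc \<nu>) \<le> C * S \<nu>" and "\<nu> \<ge> m"
  shows "S (\<nu> + d) \<le> C ^ d * S \<nu>"
proof (induction d)
  case (Suc d)
  have "S (\<nu> + Suc d) \<le> C * S (\<nu> + d)" using assms(2)[of "\<nu> + d"] assms(3) by simp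
  also have "\<dots> \<le> C * (C ^ d * S \<nu>)" using Suc assms(1) by (intro mult_left_mono)
  finally show ?case by (simp add: mult.assoc)
qed simp

text \<open>
  The sequences \<open>U\<close> and \<open>V\<close> stand for the sizes of a faster and a slower component, \<open>X\<close> and \<open>Y\<close> for
  their model growth, and \<open>S\<close> for the size of the sum of the two components. If \<open>Y\<close> exceeds \<open>X\<close> by a
  large subexponential factor at \<open>\<nu>\<close>, then the slower component dominates there and nothing more is
  needed. Otherwise the faster component dominates after the look-ahead \<open>d\<close>, and the crude growth
  of \<open>S\<close> carries its lower bound from \<open>\<nu> + d\<close> back to \<open>\<nu>\<close>. The constants \<open>D\<close> and \<open>N'\<close> come before the
  sequences because they have to serve all solutions at once.
\<close>

lemma superposition_of_rates:
  fixes A B C \<sigma> \<tau> :: real and k N :: nat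
  assumes k: "k \<ge> 1" and A: "A \<ge> 0" and B: "B \<ge> 0" and C: "C \<ge> 1"
    and rates: "0 < \<sigma>" "\<sigma> < \<tau>" and N: "N \<ge> 1"
  obtains D N' where "D \<ge> 0" and "N' \<ge> N"
    and "\<And>U V S X Y \<nu>.
      (\<And>\<nu>. \<nu> \<ge> N \<Longrightarrow> U \<nu> \<le> exp (A * growth_exponent k \<nu>) * X \<nu>) \<Longrightarrow>
      (\<And>\<nu>. \<nu> \<ge> N \<Longrightarrow> X \<nu> \<le> exp (B * growth_exponent k \<nu>) * U \<nu>) \<Longrightarrow>
      (\<And>\<nu>. \<nu> \<ge> N \<Longrightarrow> V \<nu> \<le> exp (A * growth_exponent k \<nu>) * Y \<nu>) \<Longrightarrow>
      (\<And>\<nu>. \<nu> \<ge> N \<Longrightarrow> Y \<nu> \<le> exp (A * growth_exponent k \<nu>) * V \<nu>) \<Longrightarrow>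
      (\<And>\<nu>. X \<nu> \<ge> 0) \<Longrightarrow> (\<And>\<nu>. Y \<nu> \<ge> 0) \<Longrightarrow>
      (\<And>\<nu> d. \<tau> ^ d * X \<nu> \<le> X (\<nu> + d)) \<Longrightarrow> (\<And>\<nu> d. Y (\<nu> + d) \<le> \<sigma> ^ d * Y \<nu>) \<Longrightarrow>
      (\<And>\<nu>. U \<nu> \<le> S \<nu> + V \<nu>) \<Longrightarrow> (\<And>\<nu>. V \<nu> \<le> S \<nu> + U \<nu>) \<Longrightarrow>
      (\<And>\<nu>. \<nu> \<ge> N \<Longrightarrow> S (Suc \<nu>) \<le> C * S \<nu>) \<Longrightarrow> (\<And>\<nu>. S \<nu> \<ge> 0) \<Longrightarrow>
      \<nu> \<ge> N' \<Longrightarrow> X \<nu> + Y \<nu> \<le> exp (D * growth_exponent k \<nu>) * S \<nu>"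
proof -
  define g where "g = growth_exponent k"
  define K where "K = 3 * A + B + 2"
  have e4: "4 \<le> exp (2 * x)" if "x \<ge> 1" for x :: real
  proof -
    \<comment> \<open>Used to absorb numerical constants into the exponent, which is at least \<open>1\<close>.\<close>
    have "2 \<le> exp x" using exp_ge_add_one_self[of x] that by linarith
    then have "2 * 2 \<le> exp x * exp x" by (intro mult_mono) auto
    then show ?thesis by (simp flip: exp_add)
  qed
  have "\<tau> / \<sigma> > 1" "K \<ge> 0" using rates A B by (auto simp: K_def)
  from look_ahead[OF k this] obtain L where L: "L \<ge> 0" and
    ev: "\<forall>\<^sub>F \<nu> in sequentially. \<exists>d. real d \<le> L * g \<nu> \<and>
      g (\<nu> + d) \<le> 2 * g \<nu> \<and> exp (K * g (\<nu> + d)) \<le> (\<tau> / \<sigma>) ^ d" unfolding g_def by blast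
  then obtain N0 where N0: "\<And>\<nu>. \<nu> \<ge> N0 \<Longrightarrow> \<exists>d. real d \<le> L * g \<nu> \<and>
      g (\<nu> + d) \<le> 2 * g \<nu> \<and> exp (K * g (\<nu> + d)) \<le> (\<tau> / \<sigma>) ^ d"
    unfolding eventually_sequentially by blast
  define c where "c = \<bar>ln (C / \<tau>)\<bar>"
  have c: "c \<ge> 0" "C \<le> exp c * \<tau>"
  proof -
    have "C / \<tau> = exp (ln (C / \<tau>))" using C rates by simp
    also have "\<dots> \<le> exp c" by (simp add: c_def)
    finally show "C \<le> exp c * \<tau>" using rates by (simp add: field_simps)
  qed (simp add: c_def)
  define D where "D = 2 * A + 2 * B + c * L + 4"
  show thesis
  proof (rule that[of D "max N N0"])
    show "D \<ge> 0" using A B c L by (simp add: D_def)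
    fix U V S X Y :: "nat \<Rightarrow> real" and \<nu> :: nat
    assume U_le: "\<And>\<nu>. \<nu> \<ge> N \<Longrightarrow> U \<nu> \<le> exp (A * growth_exponent k \<nu>) * X \<nu>"
      and X_le: "\<And>\<nu>. \<nu> \<ge> N \<Longrightarrow> X \<nu> \<le> exp (B * growth_exponent k \<nu>) * U \<nu>"
      and V_le: "\<And>\<nu>. \<nu> \<ge> N \<Longrightarrow> V \<nu> \<le> exp (A * growth_exponent k \<nu>) * Y \<nu>"
      and Y_le: "\<And>\<nu>. \<nu> \<ge> N \<Longrightarrow> Y \<nu> \<le> exp (A * growth_exponent k \<nu>) * V \<nu>"
      and X0: "\<And>\<nu>. X \<nu> \<ge> 0" and Y0: "\<And>\<nu>. Y \<nu> \<ge> 0"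
      and X_d: "\<And>\<nu> d. \<tau> ^ d * X \<nu> \<le> X (\<nu> + d)" and Y_d: "\<And>\<nu> d. Y (\<nu> + d) \<le> \<sigma> ^ d * Y \<nu>"
      and US: "\<And>\<nu>. U \<nu> \<le> S \<nu> + V \<nu>" and VS: "\<And>\<nu>. V \<nu> \<le> S \<nu> + U \<nu>"
      and S_step: "\<And>\<nu>. \<nu> \<ge> N \<Longrightarrow> S (Suc \<nu>) \<le> C * S \<nu>" and S0: "\<And>\<nu>. S \<nu> \<ge> 0"
      and \<nu>: "\<nu> \<ge> max N N0"
    have g1: "g \<nu> \<ge> 1" using growth_exponent_ge_1[of k \<nu>] k N \<nu> by (simp add: g_def)
    show "X \<nu> + Y \<nu> \<le> exp (D * growth_exponent k \<nu>) * S \<nu>"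
    proof (cases "2 * exp (2 * A * g \<nu>) * X \<nu> \<le> Y \<nu>")
      case True
      have "2 * exp (A * g \<nu>) * U \<nu> \<le> 2 * exp (A * g \<nu>) * (exp (A * g \<nu>) * X \<nu>)"
        using U_le[of \<nu>] \<nu> by (intro mult_left_mono) (auto simp: g_def)
      also have "\<dots> = 2 * exp (2 * A * g \<nu>) * X \<nu>" by (simp add: mult_exp_exp)
      also have "\<dots> \<le> exp (A * g \<nu>) * V \<nu>" using True Y_le[of \<nu>] \<nu> by (simp add: g_def)
      finally have "exp (A * g \<nu>) * (2 * U \<nu>) \<le> exp (A * g \<nu>) * V \<nu>" by (simp add: mult_ac)
      then have "2 * U \<nu> \<le> V \<nu>" by simp
      then have VS2: "V \<nu> \<le> 2 * S \<nu>" using VS[of \<nu>] by simp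
      have "1 * X \<nu> \<le> (2 * exp (2 * A * g \<nu>)) * X \<nu>"
      proof (rule mult_right_mono[OF _ X0])
        have "1 \<le> exp (2 * A * g \<nu>)" using A g1 by simp
        then show "1 \<le> 2 * exp (2 * A * g \<nu>)" by linarith
      qed
      then have "X \<nu> + Y \<nu> \<le> 2 * Y \<nu>" using True by simp
      also have "\<dots> \<le> 2 * (exp (A * g \<nu>) * (2 * S \<nu>))"
      proof -
        have "Y \<nu> \<le> exp (A * g \<nu>) * V \<nu>" using Y_le[of \<nu>] \<nu> by (simp add: g_def)
        also have "\<dots> \<le> exp (A * g \<nu>) * (2 * S \<nu>)" using VS2 by (intro mult_left_mono) auto
        finally show ?thesis by (simp add: mult_ac)
      qed
      also have "\<dots> = 4 * exp (A * g \<nu>) * S \<nu>" by simp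
      also have "\<dots> \<le> exp (2 * g \<nu>) * exp (A * g \<nu>) * S \<nu>"
        using e4[OF g1] S0 by (intro mult_right_mono) auto
      also have "\<dots> = exp ((2 + A) * g \<nu>) * S \<nu>" by (simp add: mult_exp_exp algebra_simps)
      also have "\<dots> \<le> exp (D * g \<nu>) * S \<nu>"
      proof -
        have "2 + A \<le> D" using A B c L by (simp add: D_def)
        then show ?thesis using g1 S0[of \<nu>] by (intro mult_right_mono) auto
      qed
      finally show ?thesis by (simp add: g_def)
    next
      case False
      \<comment> \<open>Here the two components may cancel at \<open>\<nu>\<close>; by \<open>\<nu> + d\<close> the faster one has won.\<close>
      from N0[of \<nu>] \<nu> obtain d where d: "real d \<le> L * g \<nu>" "g (\<nu> + d) \<le> 2 * g \<nu>"
        "exp (K * g (\<nu> + d)) \<le> (\<tau> / \<sigma>) ^ d" by auto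
      let ?h = "g (\<nu> + d)"
      have gh: "g \<nu> \<le> ?h" unfolding g_def using k N \<nu> by (intro growth_exponent_mono) auto
      have Y_X: "Y \<nu> \<le> 2 * exp (2 * A * g \<nu>) * X \<nu>" using False by simp
      have d3: "exp (K * ?h) * \<sigma> ^ d \<le> \<tau> ^ d"
        using d(3) rates by (simp add: power_divide field_simps)
      have "2 * exp (B * ?h) * V (\<nu> + d) \<le> 2 * exp (B * ?h) * (exp (A * ?h) * (\<sigma> ^ d * Y \<nu>))"
      proof -
        have "V (\<nu> + d) \<le> exp (A * ?h) * Y (\<nu> + d)" using V_le[of "\<nu> + d"] \<nu> by (simp add: g_def)
        also have "\<dots> \<le> exp (A * ?h) * (\<sigma> ^ d * Y \<nu>)" using Y_d by (intro mult_left_mono) auto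
        finally show ?thesis by (intro mult_left_mono) auto
      qed
      also have "\<dots> \<le> 2 * exp (B * ?h) * (exp (A * ?h) * (\<sigma> ^ d * (2 * exp (2 * A * ?h) * X \<nu>)))"
      proof -
        have "Y \<nu> \<le> 2 * exp (2 * A * ?h) * X \<nu>"
        proof (rule order_trans[OF Y_X])
          have "2 * A * g \<nu> \<le> 2 * A * ?h" using gh A by (intro mult_left_mono) auto
          then show "2 * exp (2 * A * g \<nu>) * X \<nu> \<le> 2 * exp (2 * A * ?h) * X \<nu>"
            using X0 by (intro mult_right_mono) auto
        qed
        then show ?thesis using rates by (intro mult_left_mono) auto
      qed
      also have "\<dots> = 4 * exp ((3 * A + B) * ?h) * \<sigma> ^ d * X \<nu>"
        by (simp add: mult_exp_exp algebra_simps)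
      also have "\<dots> \<le> exp (2 * ?h) * exp ((3 * A + B) * ?h) * \<sigma> ^ d * X \<nu>"
        using e4[of ?h] g1 gh X0 rates by (intro mult_right_mono) auto
      also have "\<dots> = exp (K * ?h) * \<sigma> ^ d * X \<nu>"
        by (simp add: K_def mult_exp_exp algebra_simps)
      also have "\<dots> \<le> \<tau> ^ d * X \<nu>" using d3 X0 by (intro mult_right_mono) auto
      also have "\<dots> \<le> X (\<nu> + d)" by (rule X_d)
      also have "\<dots> \<le> exp (B * ?h) * U (\<nu> + d)" using X_le[of "\<nu> + d"] \<nu> by (simp add: g_def)
      finally have "exp (B * ?h) * (2 * V (\<nu> + d)) \<le> exp (B * ?h) * U (\<nu> + d)" by (simp add: mult_ac)
      then have "2 * V (\<nu> + d) \<le> U (\<nu> + d)" by simp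
      then have US2: "U (\<nu> + d) \<le> 2 * S (\<nu> + d)" using US[of "\<nu> + d"] by simp
      \<comment> \<open>Return from \<open>\<nu> + d\<close> to \<open>\<nu>\<close>; the factor \<open>(C / \<tau>) ^ d\<close> is harmless because \<open>d \<le> L * g \<nu>\<close>.\<close>
      have "\<tau> ^ d * X \<nu> \<le> exp (B * ?h) * U (\<nu> + d)"
        using X_d[of d \<nu>] X_le[of "\<nu> + d"] \<nu> by (simp add: g_def)
      also have "\<dots> \<le> exp (B * (2 * g \<nu>)) * (2 * S (\<nu> + d))"
        using US2 d(2) B S0[of "\<nu> + d"]
        by (intro order_trans[OF mult_left_mono mult_right_mono]) (auto intro!: mult_left_mono)
      also have "\<dots> \<le> exp (B * (2 * g \<nu>)) * (2 * ((exp c * \<tau>) ^ d * S \<nu>))"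
      proof -
        have "S (\<nu> + d) \<le> C ^ d * S \<nu>"
          using iterate_crude_growth[of C N S \<nu> d] S_step C \<nu> by auto
        also have "\<dots> \<le> (exp c * \<tau>) ^ d * S \<nu>"
          using c C S0 by (intro mult_right_mono power_mono) auto
        finally show ?thesis by simp
      qed
      also have "\<dots> = \<tau> ^ d * (2 * exp (B * (2 * g \<nu>)) * exp (real d * c) * S \<nu>)"
        by (simp add: power_mult_distrib exp_of_nat_mult)
      finally have "X \<nu> \<le> 2 * exp (B * (2 * g \<nu>)) * exp (real d * c) * S \<nu>"
        using rates by simp
      also have "\<dots> \<le> exp (2 * g \<nu>) * exp (B * (2 * g \<nu>)) * exp (L * g \<nu> * c) * S \<nu>"
        using e4[OF g1] d(1) c S0 by (intro mult_right_mono mult_mono) (auto intro: mult_right_mono)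
      finally have X_S: "X \<nu> \<le> exp ((2 + 2 * B + c * L) * g \<nu>) * S \<nu>"
        by (simp add: mult_exp_exp algebra_simps)
      have "X \<nu> + Y \<nu> \<le> 4 * exp (2 * A * g \<nu>) * X \<nu>"
      proof -
        have "1 \<le> exp (2 * A * g \<nu>)" using A g1 by simp
        then have "1 * X \<nu> \<le> exp (2 * A * g \<nu>) * X \<nu>" using X0 by (intro mult_right_mono) auto
        moreover have "0 \<le> exp (2 * A * g \<nu>) * X \<nu>" using X0 by simp
        ultimately show ?thesis using Y_X by linarith
      qed
      also have "\<dots> \<le> exp (2 * g \<nu>) * exp (2 * A * g \<nu>) * (exp ((2 + 2 * B + c * L) * g \<nu>) * S \<nu>)"
        using e4[OF g1] X_S X0 by (intro mult_mono) auto
      also have "\<dots> = exp (D * g \<nu>) * S \<nu>"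
        by (simp add: D_def mult_exp_exp algebra_simps)
      finally show ?thesis by (simp add: g_def)
    qed
  qed simp
qed

section \<open>The window norm of a solution\<close>

lemma omega_ge:
  assumes "i < n"
  shows "cmod (y (\<nu> + i)) \<le> omega n y \<nu>"
  unfolding omega_def using assms by (intro Max_ge) auto

lemma omega_le:
  assumes "n \<ge> 1" and "\<And>i. i < n \<Longrightarrow> cmod (y (\<nu> + i)) \<le> b"
  shows "omega n y \<nu> \<le> b"
  unfolding omega_def using assms by (subst Max_le_iff) (auto simp: lessThan_empty_iff)

lemma omega_nonneg:
  assumes "n \<ge> 1"
  shows "0 \<le> omega n y \<nu>"
  using omega_ge[of 0 n y \<nu>] assms norm_ge_zero[of "y (\<nu> + 0)"] by linarith

lemma omega_zero: "n \<ge> 1 \<Longrightarrow> omega n 0 \<nu> = 0"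
  using omega_le[of n 0 \<nu> 0] omega_nonneg[of n 0 \<nu>] by auto

lemma omega_add_le:
  assumes "n \<ge> 1"
  shows "omega n (x + y) \<nu> \<le> omega n x \<nu> + omega n y \<nu>"
proof (rule omega_le[OF assms])
  fix i assume "i < n"
  then show "cmod ((x + y) (\<nu> + i)) \<le> omega n x \<nu> + omega n y \<nu>"
    using norm_triangle_ineq[of "x (\<nu> + i)" "y (\<nu> + i)"]
      omega_ge[of i n x \<nu>] omega_ge[of i n y \<nu>] by simp
qed

lemma omega_scale_le:
  assumes "n \<ge> 1"
  shows "omega n (seq_scale c y) \<nu> \<le> cmod c * omega n y \<nu>"
  using assms by (intro omega_le) (auto simp: seq_scale_def norm_mult intro!: mult_left_mono omega_ge)

lemma omega_uminus: "omega n (- y) \<nu> = omega n y \<nu>"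
  by (simp add: omega_def)

lemma omega_sum_le:
  assumes "n \<ge> 1" and "finite I"
  shows "omega n (\<Sum>i\<in>I. f i) \<nu> \<le> (\<Sum>i\<in>I. omega n (f i) \<nu>)"
  using assms(2)
proof (induction I rule: finite_induct)
  case empty
  then show ?case by (simp only: sum.empty omega_zero[OF assms(1)] order.refl)
next
  case (insert i I)
  have "(\<Sum>j\<in>insert i I. f j) = f i + (\<Sum>j\<in>I. f j)" by (rule sum.insert[OF insert.hyps])
  then have "omega n (\<Sum>j\<in>insert i I. f j) \<nu> \<le> omega n (f i) \<nu> + omega n (\<Sum>j\<in>I. f j) \<nu>"
    using omega_add_le[OF assms(1), of "f i" "\<Sum>j\<in>I. f j" \<nu>] by (simp only:)
  also have "\<dots> \<le> omega n (f i) \<nu> + (\<Sum>j\<in>I. omega n (f j) \<nu>)" using insert.IH by (rule add_left_mono)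
  also have "\<dots> = (\<Sum>j\<in>insert i I. omega n (f j) \<nu>)" by (rule sum.insert[OF insert.hyps, symmetric])
  finally show ?case .
qed

lemma seq_scale_apply: "seq_scale c y \<nu> = c * y \<nu>"
  by (simp add: seq_scale_def)

lemma subspace_solution_space: "seq.subspace (solution_space n a m)"
proof (rule seq.subspaceI)
  fix x y assume "x \<in> solution_space n a m" "y \<in> solution_space n a m"
  then show "x + y \<in> solution_space n a m"
    by (auto simp: solution_space_def distrib_left sum.distrib)
next
  fix c x assume x: "x \<in> solution_space n a m"
  have "(\<Sum>k\<le>n. a k \<nu> * (c * x (\<nu> + k))) = c * (\<Sum>k\<le>n. a k \<nu> * x (\<nu> + k))" for \<nu>
    by (simp add: sum_distrib_left mult_ac)
  with x show "seq_scale c x \<in> solution_space n a m"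
    by (auto simp: solution_space_def seq_scale_def)
qed (simp add: solution_space_def)

lemma solution_next_value:
  assumes "a n \<nu> = 1" and "y \<in> solution_space n a m" and "\<nu> \<ge> m"
  shows "y (\<nu> + n) = - (\<Sum>k<n. a k \<nu> * y (\<nu> + k))"
proof -
  have "(\<Sum>k\<le>n. a k \<nu> * y (\<nu> + k)) = 0" using assms by (simp add: solution_space_def)
  moreover have "{..n} = insert n {..<n}" by auto
  ultimately show ?thesis using assms(1) by (simp add: eq_neg_iff_add_eq_0)
qed

text \<open>
  The window moves by one place: all its values but the last are old ones, and the last one is given
  by the recurrence, whose leading coefficient is \<open>1\<close>.
\<close>

lemma solution_crude_growth:
  assumes "n \<ge> 1" and "\<And>\<nu>. a n \<nu> = 1" and "\<And>k \<nu>. k < n \<Longrightarrow> cmod (a k \<nu>) \<le> b"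
    and "y \<in> solution_space n a m" and "\<nu> \<ge> m"
  shows "omega n y (Suc \<nu>) \<le> max 1 (real n * b) * omega n y \<nu>"
proof (rule omega_le[OF \<open>n \<ge> 1\<close>])
  fix i assume i: "i < n"
  show "cmod (y (Suc \<nu> + i)) \<le> max 1 (real n * b) * omega n y \<nu>"
  proof (cases "Suc i < n")
    case True
    have "cmod (y (Suc \<nu> + i)) \<le> 1 * omega n y \<nu>" using omega_ge[OF True, of y \<nu>] by simp
    also have "\<dots> \<le> max 1 (real n * b) * omega n y \<nu>"
      by (intro mult_right_mono omega_nonneg assms) auto
    finally show ?thesis .
  next
    case False
    with i have "Suc \<nu> + i = \<nu> + n" by simp
    then have "cmod (y (Suc \<nu> + i)) = cmod (\<Sum>k<n. a k \<nu> * y (\<nu> + k))"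
      using solution_next_value[of a n \<nu> y m] assms(2,4,5) by (simp only: norm_minus_cancel)
    also have "\<dots> \<le> (\<Sum>k<n. b * omega n y \<nu>)"
      using assms(1,3) by (intro sum_norm_le)
        (auto simp: norm_mult intro!: mult_mono omega_ge order_trans[OF norm_ge_zero assms(3)])
    also have "\<dots> = (real n * b) * omega n y \<nu>" by simp
    also have "\<dots> \<le> max 1 (real n * b) * omega n y \<nu>"
      by (intro mult_right_mono omega_nonneg assms) auto
    finally show ?thesis .
  qed
qed

lemma solution_eq_zero:
  assumes "\<And>\<nu>. a n \<nu> = 1" and "y \<in> solution_space n a m" and "\<And>i. i < n \<Longrightarrow> y (m + i) = 0"
  shows "y = 0"
proof -
  have "y \<nu> = 0" for \<nu>
  proof (induction \<nu> rule: less_induct)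
    case (less \<nu>)
    consider "\<nu> < m" | "m \<le> \<nu>" "\<nu> < m + n" | "\<nu> \<ge> m + n" by linarith
    then show ?case
    proof cases
      case 1
      then show ?thesis using assms(2) by (simp add: solution_space_def)
    next
      case 2
      then show ?thesis using assms(3)[of "\<nu> - m"] by simp
    next
      case 3
      have "y (\<nu> - n + n) = - (\<Sum>k<n. a k (\<nu> - n) * y (\<nu> - n + k))"
        using assms 3 by (intro solution_next_value) auto
      also have "\<dots> = 0" using less 3 by simp
      finally show ?thesis using 3 by simp
    qed
  qed
  then show ?thesis by auto
qed

section \<open>Separating functionals on spaces of sequences\<close>

text \<open>
  A quantitative form of injectivity, by induction on the functionals: unless \<open>\<phi> i\<close> vanishes on \<open>V\<close>,
  the space is spanned by its kernel, where the other functionals separate points, and one vector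
  normalised by \<open>\<phi> i v = 1\<close>. Linearity is stated on \<open>V\<close> only, because the component maps of a direct
  sum are linear only there.
\<close>

lemma seminorm_le_separating_functionals:
  fixes \<phi> :: "'i \<Rightarrow> (nat \<Rightarrow> complex) \<Rightarrow> complex" and p :: "(nat \<Rightarrow> complex) \<Rightarrow> real"
  assumes "finite I" and "seq.subspace V"
    and "\<And>i x y. i \<in> I \<Longrightarrow> x \<in> V \<Longrightarrow> y \<in> V \<Longrightarrow> \<phi> i (x + y) = \<phi> i x + \<phi> i y"
    and "\<And>i c x. i \<in> I \<Longrightarrow> x \<in> V \<Longrightarrow> \<phi> i (seq_scale c x) = c * \<phi> i x"
    and "\<And>x. x \<in> V \<Longrightarrow> (\<And>i. i \<in> I \<Longrightarrow> \<phi> i x = 0) \<Longrightarrow> x = 0"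
    and "\<And>x y. x \<in> V \<Longrightarrow> y \<in> V \<Longrightarrow> p (x + y) \<le> p x + p y"
    and "\<And>c x. x \<in> V \<Longrightarrow> p (seq_scale c x) \<le> cmod c * p x"
  shows "\<exists>C\<ge>0. \<forall>x\<in>V. p x \<le> C * (\<Sum>i\<in>I. cmod (\<phi> i x))"
  using assms
proof (induction I arbitrary: V rule: finite_induct)
  case empty
  have "p x \<le> 0" if "x \<in> V" for x
  proof -
    have "x = seq_scale 0 x" using empty.prems(4)[OF that] by (simp add: seq_scale_def fun_eq_iff)
    then have "p x = p (seq_scale 0 x)" by (rule arg_cong)
    also have "\<dots> \<le> 0" using empty.prems(6)[OF that, of 0] by (simp only: norm_zero mult_zero_left)
    finally show ?thesis .
  qed
  then show ?case by auto
next
  case (insert i I)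
  note sub = \<open>seq.subspace V\<close>
  note add = insert.prems(2) and scale = insert.prems(3) and sep = insert.prems(4)
    and p_add = insert.prems(5) and p_scale = insert.prems(6)
  define V' where "V' = {x \<in> V. \<phi> i x = 0}"
  have phi0: "\<phi> i 0 = 0"
    using scale[of i 0 0] seq.subspace_0[OF sub] by (simp add: seq_scale_def zero_fun_def)
  have sub': "seq.subspace V'"
    unfolding V'_def using sub phi0
    by (intro seq.subspaceI) (auto simp: add scale seq.subspace_0 seq.subspace_add seq.subspace_scale)
  have "\<exists>C\<ge>0. \<forall>x\<in>V'. p x \<le> C * (\<Sum>i\<in>I. cmod (\<phi> i x))"
  proof (rule insert.IH[OF sub'])
    fix x assume x: "x \<in> V'" "\<And>j. j \<in> I \<Longrightarrow> \<phi> j x = 0"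
    show "x = 0" by (rule sep) (use x in \<open>auto simp: V'_def\<close>)
  qed (use add scale p_add p_scale in \<open>auto simp: V'_def\<close>)
  then obtain C where C: "C \<ge> 0" "\<And>x. x \<in> V' \<Longrightarrow> p x \<le> C * (\<Sum>i\<in>I. cmod (\<phi> i x))" by blast
  show ?case
  proof (cases "\<exists>v\<in>V. \<phi> i v \<noteq> 0")
    case False
    then have "x \<in> V'" if "x \<in> V" for x using that by (auto simp: V'_def)
    then have "p x \<le> C * (\<Sum>j\<in>insert i I. cmod (\<phi> j x))" if "x \<in> V" for x
      using C(2)[of x] that insert.hyps False by auto
    then show ?thesis using C(1) by blast
  next
    case True
    then obtain v0 where v0: "v0 \<in> V" "\<phi> i v0 \<noteq> 0" by blast
    define v where "v = seq_scale (1 / \<phi> i v0) v0"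
    have v: "v \<in> V" "\<phi> i v = 1"
      using v0 scale[of i v0] sub by (auto simp: v_def seq.subspace_scale)
    define M where "M = (\<Sum>j\<in>I. cmod (\<phi> j v))"
    define C' where "C' = C + C * M + \<bar>p v\<bar>"
    have M: "M \<ge> 0" by (simp add: M_def sum_nonneg)
    have "p x \<le> C' * (\<Sum>j\<in>insert i I. cmod (\<phi> j x))" if x: "x \<in> V" for x
    proof -
      define z where "z = x + seq_scale (- \<phi> i x) v"
      let ?S = "\<Sum>j\<in>I. cmod (\<phi> j x)" and ?t = "cmod (\<phi> i x)"
      have v': "seq_scale (- \<phi> i x) v \<in> V" by (rule seq.subspace_scale[OF sub v(1)])
      have \<phi>_z: "\<phi> j z = \<phi> j x - \<phi> i x * \<phi> j v" if j: "j \<in> insert i I" for j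
      proof -
        have "\<phi> j z = \<phi> j x + \<phi> j (seq_scale (- \<phi> i x) v)"
          unfolding z_def by (rule add[OF j x v'])
        also have "\<dots> = \<phi> j x - \<phi> i x * \<phi> j v" unfolding scale[OF j v(1)] by simp
        finally show ?thesis .
      qed
      have "z \<in> V" unfolding z_def by (rule seq.subspace_add[OF sub x v'])
      then have z: "z \<in> V'" using \<phi>_z[of i] v(2) by (simp add: V'_def)
      have xz: "x = z + seq_scale (\<phi> i x) v" by (simp add: z_def seq_scale_def fun_eq_iff)
      have "(\<Sum>j\<in>I. cmod (\<phi> j z)) \<le> (\<Sum>j\<in>I. cmod (\<phi> j x) + ?t * cmod (\<phi> j v))"
      proof (rule sum_mono)
        fix j assume j: "j \<in> I"
        show "cmod (\<phi> j z) \<le> cmod (\<phi> j x) + ?t * cmod (\<phi> j v)"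
          using norm_triangle_ineq4[of "\<phi> j x" "\<phi> i x * \<phi> j v"] \<phi>_z[of j] j
          by (simp add: norm_mult)
      qed
      also have "\<dots> = ?S + ?t * M" by (simp add: sum.distrib sum_distrib_left M_def)
      finally have sum_z: "(\<Sum>j\<in>I. cmod (\<phi> j z)) \<le> ?S + ?t * M" .
      have "p x \<le> p z + p (seq_scale (\<phi> i x) v)"
        using xz p_add[of z "seq_scale (\<phi> i x) v"] z v sub
        by (auto simp: V'_def seq.subspace_scale)
      also have "\<dots> \<le> C * (?S + ?t * M) + ?t * \<bar>p v\<bar>"
      proof (rule add_mono)
        show "p z \<le> C * (?S + ?t * M)"
          using C(2)[OF z] mult_left_mono[OF sum_z C(1)] by linarith
        show "p (seq_scale (\<phi> i x) v) \<le> ?t * \<bar>p v\<bar>"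
          by (rule order_trans[OF p_scale[OF v(1)] mult_left_mono[OF abs_ge_self norm_ge_zero]])
      qed
      also have "\<dots> \<le> C' * (?t + ?S)"
      proof -
        have S: "?S \<ge> 0" by (simp add: sum_nonneg)
        have "0 \<le> C * ?t" "0 \<le> C * M * ?S" "0 \<le> \<bar>p v\<bar> * ?S"
          using C(1) M S by (simp_all add: mult_nonneg_nonneg del: abs_ge_zero)
        then show ?thesis by (simp add: C'_def algebra_simps)
      qed
      finally show ?thesis using insert.hyps by simp
    qed
    moreover have "C' \<ge> 0" using C(1) M by (simp add: C'_def)
    ultimately show ?thesis by blast
  qed
qed

text \<open>
  Guards against the convention that an infinite basis has cardinality \<open>0\<close>: only in finite dimension
  does dimension \<open>0\<close> mean that the space is zero.
\<close>

lemma finite_span_if_finitely_separated: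
  fixes V :: "(nat \<Rightarrow> complex) set"
  assumes "finite I" and "seq.subspace V"
    and "\<And>x. x \<in> V \<Longrightarrow> (\<And>i. i \<in> I \<Longrightarrow> x i = 0) \<Longrightarrow> x = 0"
  shows "\<exists>B. finite B \<and> V \<subseteq> seq.span B"
  using assms
proof (induction I arbitrary: V rule: finite_induct)
  case empty
  then have "V \<subseteq> {0}" by blast
  then have "V \<subseteq> seq.span {}" by (simp only: seq.span_empty)
  then show ?case by blast
next
  case (insert i I)
  define V' where "V' = {x \<in> V. x i = 0}"
  have sub': "seq.subspace V'"
  proof (rule seq.subspaceI)
    show "0 \<in> V'" using seq.subspace_0[OF insert.prems(1)] by (auto simp: V'_def)
    show "x + y \<in> V'" if "x \<in> V'" "y \<in> V'" for x y
      using seq.subspace_add[OF insert.prems(1), of x y] that by (auto simp: V'_def)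
    show "seq_scale c x \<in> V'" if "x \<in> V'" for c x
      using seq.subspace_scale[OF insert.prems(1), of x c] that by (auto simp: V'_def seq_scale_apply)
  qed
  have "\<exists>B. finite B \<and> V' \<subseteq> seq.span B"
  proof (rule insert.IH[OF sub'])
    fix x assume x: "x \<in> V'" "\<And>j. j \<in> I \<Longrightarrow> x j = 0"
    show "x = 0" by (rule insert.prems(2)) (use x in \<open>auto simp: V'_def\<close>)
  qed
  then obtain B where B: "finite B" "V' \<subseteq> seq.span B" by blast
  show ?case
  proof (cases "\<exists>v\<in>V. v i \<noteq> 0")
    case False
    then show ?thesis using B by (auto simp: V'_def)
  next
    case True
    then obtain v where v: "v \<in> V" "v i \<noteq> 0" by blast
    have "x \<in> seq.span (insert v B)" if x: "x \<in> V" for x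
    proof -
      have "x - seq_scale (x i / v i) v \<in> V'"
      proof -
        have "x - seq_scale (x i / v i) v \<in> V"
          using x v insert.prems(1) seq.subspace_diff seq.subspace_scale by blast
        then show ?thesis using v by (simp add: V'_def seq_scale_apply)
      qed
      then show ?thesis using B(2) unfolding seq.span_insert by blast
    qed
    then show ?thesis using B(1) by (intro exI[of _ "insert v B"]) auto
  qed
qed

lemma subspace_dim_0_eq_zero:
  assumes "\<And>\<nu>. a n \<nu> = 1" and "seq.subspace U" and "U \<subseteq> solution_space n a m" and "seq.dim U = 0"
  shows "U = {0}"
proof -
  obtain F where F: "finite F" "U \<subseteq> seq.span F"
    using finite_span_if_finitely_separated[of "{m..<m + n}" U] assms(2,3)
      solution_eq_zero[of a n _ m] assms(1) by (force simp: subset_iff)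
  obtain B where B: "B \<subseteq> U" "seq.independent B" "U \<subseteq> seq.span B" "card B = seq.dim U"
    using seq.basis_exists by blast
  have "finite B" using seq.independent_span_bound[OF F(1) B(2)] B(1) F(2) by blast
  then have "B = {}" using B(4) assms(4) by simp
  then show ?thesis using B(3) seq.subspace_0[OF assms(2)] by auto
qed

section \<open>Components of a direct sum\<close>

text \<open>
  Existence of the components is the definition of the sum; linearity is their uniqueness.
\<close>

lemma direct_sum_components:
  assumes "is_direct_sum U I W"
  obtains P where "\<And>i y. y \<in> U \<Longrightarrow> i \<in> I \<Longrightarrow> P i y \<in> W i"
    and "\<And>y. y \<in> U \<Longrightarrow> y = (\<Sum>i\<in>I. P i y)"
    and "\<And>i x y. i \<in> I \<Longrightarrow> x \<in> U \<Longrightarrow> y \<in> U \<Longrightarrow> P i (x + y) = P i x + P i y"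
    and "\<And>i c x. i \<in> I \<Longrightarrow> x \<in> U \<Longrightarrow> P i (seq_scale c x) = seq_scale c (P i x)"
proof -
  have sub: "\<And>i. i \<in> I \<Longrightarrow> seq.subspace (W i)" and U: "U = sum_of_spaces I W"
    and ind: "\<And>f. (\<And>i. i \<in> I \<Longrightarrow> f i \<in> W i) \<Longrightarrow> (\<Sum>i\<in>I. f i) = 0 \<Longrightarrow> (\<forall>i\<in>I. f i = 0)"
    using assms unfolding is_direct_sum_def by blast+
  have "\<forall>y\<in>U. \<exists>f. (\<forall>i\<in>I. f i \<in> W i) \<and> y = (\<Sum>i\<in>I. f i)"
    unfolding U sum_of_spaces_def by blast
  then obtain Q where Q: "\<And>y i. y \<in> U \<Longrightarrow> i \<in> I \<Longrightarrow> Q y i \<in> W i" "\<And>y. y \<in> U \<Longrightarrow> y = (\<Sum>i\<in>I. Q y i)"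
    by metis
  have unique: "Q y i = f i" if "y \<in> U" "\<And>i. i \<in> I \<Longrightarrow> f i \<in> W i" "y = (\<Sum>i\<in>I. f i)" "i \<in> I" for y f i
  proof -
    have "(\<Sum>i\<in>I. Q y i - f i) = 0" 
      using trans[OF Q(2)[OF that(1), symmetric] that(3)] by (simp only: sum_subtractf diff_self)
    then have "Q y i - f i = 0"
      using ind[of "\<lambda>i. Q y i - f i"] that Q(1) sub seq.subspace_diff by blast
    then show ?thesis by (simp only: right_minus_eq)
  qed
  have scale_sum: "seq_scale c (\<Sum>i\<in>I. f i) = (\<Sum>i\<in>I. seq_scale c (f i))" for c f
    by (rule seq.scale_sum_right)
  show thesis
  proof (rule that[of "\<lambda>i y. Q y i"])
    fix i x y assume *: "i \<in> I" "x \<in> U" "y \<in> U"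
    have mem: "Q x j + Q y j \<in> W j" if "j \<in> I" for j using Q(1) * that sub by (simp add: seq.subspace_add)
    have eq: "x + y = (\<Sum>i\<in>I. Q x i + Q y i)"
      unfolding sum.distrib by (rule arg_cong2[OF Q(2)[OF *(2)] Q(2)[OF *(3)]])
    have "x + y \<in> U" unfolding U sum_of_spaces_def using eq mem by blast
    then show "Q (x + y) i = Q x i + Q y i" by (rule unique[OF _ mem eq *(1)])
  next
    fix i c x assume *: "i \<in> I" "x \<in> U"
    have mem: "seq_scale c (Q x j) \<in> W j" if "j \<in> I" for j
      using Q(1) * that sub by (simp add: seq.subspace_scale)
    have eq: "seq_scale c x = (\<Sum>i\<in>I. seq_scale c (Q x i))"
      unfolding scale_sum[symmetric] by (rule arg_cong[OF Q(2)[OF *(2)]])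
    have "seq_scale c x \<in> U" unfolding U sum_of_spaces_def using eq mem by blast
    then show "Q (seq_scale c x) i = seq_scale c (Q x i)" by (rule unique[OF _ mem eq *(1)])
  qed (use Q in auto)
qed

lemma summand_subset_sum_of_spaces:
  assumes "finite I" and "\<And>i. i \<in> I \<Longrightarrow> seq.subspace (W i)" and "i \<in> I"
  shows "W i \<subseteq> sum_of_spaces I W"
proof
  fix w assume "w \<in> W i"
  then have "(\<forall>j\<in>I. (if j = i then w else 0) \<in> W j)" using assms by (auto simp: seq.subspace_0)
  moreover have "w = (\<Sum>j\<in>I. if j = i then w else 0)" using assms by simp
  ultimately show "w \<in> sum_of_spaces I W" unfolding sum_of_spaces_def by blast
qed

section \<open>Sums of components with positive rates\<close>

text \<open>
  Components of different positive rates cannot cancel more than subexponentially: in the induction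
  step the sum of the first \<open>r\<close> components, whose slowest rate is \<open>\<rho> r\<close>, is the faster and
  \<open>w (Suc r)\<close> the slower part of a superposition of rates.
\<close>

lemma component_sum_lower_bound:
  fixes \<rho> :: "nat \<Rightarrow> real" and W :: "nat \<Rightarrow> (nat \<Rightarrow> complex) set"
  assumes n: "n \<ge> 1" and m: "m \<ge> 1" and k: "k \<ge> 1" and A: "A \<ge> 0" and C: "C \<ge> 1"
    and S: "seq.subspace S" and W: "\<And>j. 1 \<le> j \<Longrightarrow> j \<le> \<theta> \<Longrightarrow> W j \<subseteq> S"
    and pos: "\<And>j. 1 \<le> j \<Longrightarrow> j \<le> \<theta> \<Longrightarrow> \<rho> j > 0"
    and dec: "\<And>i j. 1 \<le> i \<Longrightarrow> i < j \<Longrightarrow> j \<le> \<theta> \<Longrightarrow> \<rho> j < \<rho> i"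
    and growth: "\<And>y \<nu>. y \<in> S \<Longrightarrow> \<nu> \<ge> m \<Longrightarrow> omega n y (Suc \<nu>) \<le> C * omega n y \<nu>"
    and upper: "\<And>j y \<nu>. 1 \<le> j \<Longrightarrow> j \<le> \<theta> \<Longrightarrow> y \<in> W j \<Longrightarrow> \<nu> \<ge> m \<Longrightarrow>
      omega n y \<nu> \<le> exp (A * growth_exponent k \<nu>) * (\<rho> j ^ \<nu> * omega n y m)"
    and lower: "\<And>j y \<nu>. 1 \<le> j \<Longrightarrow> j \<le> \<theta> \<Longrightarrow> y \<in> W j \<Longrightarrow> \<nu> \<ge> m \<Longrightarrow>
      \<rho> j ^ \<nu> * omega n y m \<le> exp (A * growth_exponent k \<nu>) * omega n y \<nu>"
    and "1 \<le> r" and "r \<le> \<theta>"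
  shows "\<exists>B\<ge>0. \<exists>N\<ge>m. \<forall>w. (\<forall>j\<in>{1..r}. w j \<in> W j) \<longrightarrow> (\<forall>\<nu>\<ge>N.
    (\<Sum>j=1..r. \<rho> j ^ \<nu> * omega n (w j) m)
      \<le> exp (B * growth_exponent k \<nu>) * omega n (\<Sum>j=1..r. w j) \<nu>)"
  using \<open>1 \<le> r\<close> \<open>r \<le> \<theta>\<close>
proof (induction r rule: nat_induct_at_least)
  case base
  show ?case
  proof (intro exI[of _ A] exI[of _ m] conjI allI impI)
    fix w :: "nat \<Rightarrow> nat \<Rightarrow> complex" and \<nu>
    assume w: "\<forall>j\<in>{1..1}. w j \<in> W j" and \<nu>: "m \<le> \<nu>"
    have "\<rho> 1 ^ \<nu> * omega n (w 1) m \<le> exp (A * growth_exponent k \<nu>) * omega n (w 1) \<nu>"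
      using w \<nu> base by (intro lower) auto
    then show "(\<Sum>j=1..1. \<rho> j ^ \<nu> * omega n (w j) m)
        \<le> exp (A * growth_exponent k \<nu>) * omega n (\<Sum>j=1..1. w j) \<nu>"
      by (simp only: atLeastAtMost_singleton sum.insert finite.emptyI empty_iff not_False_eq_True
        sum.empty add_0_right)
  qed (use A in auto)
next
  case (Suc r)
  then obtain B N where B: "B \<ge> 0" and N: "N \<ge> m" and
    IH: "\<And>w \<nu>. (\<forall>j\<in>{1..r}. w j \<in> W j) \<Longrightarrow> \<nu> \<ge> N \<Longrightarrow>
      (\<Sum>j=1..r. \<rho> j ^ \<nu> * omega n (w j) m)
        \<le> exp (B * growth_exponent k \<nu>) * omega n (\<Sum>j=1..r. w j) \<nu>"
    by fastforce
  have rates: "0 < \<rho> (Suc r)" "\<rho> (Suc r) < \<rho> r" using pos dec Suc by auto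
  have "N \<ge> 1" using m N by simp
  from superposition_of_rates[OF k A B C rates this] obtain D N' where D: "D \<ge> 0" and N': "N' \<ge> N"
    and sup: "\<And>U V S X Y \<nu>.
      (\<And>\<nu>. \<nu> \<ge> N \<Longrightarrow> U \<nu> \<le> exp (A * growth_exponent k \<nu>) * X \<nu>) \<Longrightarrow>
      (\<And>\<nu>. \<nu> \<ge> N \<Longrightarrow> X \<nu> \<le> exp (B * growth_exponent k \<nu>) * U \<nu>) \<Longrightarrow>
      (\<And>\<nu>. \<nu> \<ge> N \<Longrightarrow> V \<nu> \<le> exp (A * growth_exponent k \<nu>) * Y \<nu>) \<Longrightarrow>
      (\<And>\<nu>. \<nu> \<ge> N \<Longrightarrow> Y \<nu> \<le> exp (A * growth_exponent k \<nu>) * V \<nu>) \<Longrightarrow>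
      (\<And>\<nu>. X \<nu> \<ge> 0) \<Longrightarrow> (\<And>\<nu>. Y \<nu> \<ge> 0) \<Longrightarrow>
      (\<And>\<nu> d. \<rho> r ^ d * X \<nu> \<le> X (\<nu> + d)) \<Longrightarrow> (\<And>\<nu> d. Y (\<nu> + d) \<le> \<rho> (Suc r) ^ d * Y \<nu>) \<Longrightarrow>
      (\<And>\<nu>. U \<nu> \<le> S \<nu> + V \<nu>) \<Longrightarrow> (\<And>\<nu>. V \<nu> \<le> S \<nu> + U \<nu>) \<Longrightarrow>
      (\<And>\<nu>. \<nu> \<ge> N \<Longrightarrow> S (Suc \<nu>) \<le> C * S \<nu>) \<Longrightarrow> (\<And>\<nu>. S \<nu> \<ge> 0) \<Longrightarrow>
      \<nu> \<ge> N' \<Longrightarrow> X \<nu> + Y \<nu> \<le> exp (D * growth_exponent k \<nu>) * S \<nu>" by blast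
  show ?case
  proof (intro exI[of _ D] exI[of _ N'] conjI allI impI)
    fix w :: "nat \<Rightarrow> nat \<Rightarrow> complex" and \<nu>
    assume w: "\<forall>j\<in>{1..Suc r}. w j \<in> W j" and \<nu>: "N' \<le> \<nu>"
    define u where "u = (\<Sum>j=1..r. w j)"
    have all: "(\<Sum>j=1..Suc r. w j) = u + w (Suc r)"
      unfolding u_def using Suc.hyps by (subst sum.nat_ivl_Suc'[OF le_SucI]) (assumption, rule add.commute)
    have mem_S: "w j \<in> S" if "j \<in> {1..Suc r}" for j using w W that Suc.prems by force
    have u_S: "u \<in> S" unfolding u_def using mem_S S by (intro seq.subspace_sum) auto
    define X where "X = (\<lambda>\<nu>. \<Sum>j=1..r. \<rho> j ^ \<nu> * omega n (w j) m)"
    define Y where "Y = (\<lambda>\<nu>. \<rho> (Suc r) ^ \<nu> * omega n (w (Suc r)) m)"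
    have "X \<nu> + Y \<nu> \<le> exp (D * growth_exponent k \<nu>) * omega n (u + w (Suc r)) \<nu>"
    proof (rule sup[where U = "omega n u" and V = "omega n (w (Suc r))"])
      fix \<mu> assume \<mu>: "N \<le> \<mu>"
      have "omega n u \<mu> \<le> (\<Sum>j=1..r. omega n (w j) \<mu>)" unfolding u_def using n by (intro omega_sum_le) auto
      also have "\<dots> \<le> (\<Sum>j=1..r. exp (A * growth_exponent k \<mu>) * (\<rho> j ^ \<mu> * omega n (w j) m))"
        using w \<mu> N Suc.prems by (intro sum_mono upper) auto
      also have "\<dots> = exp (A * growth_exponent k \<mu>) * X \<mu>" by (simp only: X_def sum_distrib_left)
      finally show "omega n u \<mu> \<le> exp (A * growth_exponent k \<mu>) * X \<mu>" .
      show "X \<mu> \<le> exp (B * growth_exponent k \<mu>) * omega n u \<mu>"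
        unfolding X_def u_def using w \<mu> by (intro IH) auto
      show "omega n (w (Suc r)) \<mu> \<le> exp (A * growth_exponent k \<mu>) * Y \<mu>"
        unfolding Y_def using w \<mu> N Suc.prems by (intro upper) auto
      show "Y \<mu> \<le> exp (A * growth_exponent k \<mu>) * omega n (w (Suc r)) \<mu>"
        unfolding Y_def using w \<mu> N Suc.prems by (intro lower) auto
      show "omega n (u + w (Suc r)) (Suc \<mu>) \<le> C * omega n (u + w (Suc r)) \<mu>"
        using \<mu> N seq.subspace_add[OF S u_S mem_S[of "Suc r"]] by (intro growth) auto
    next
      fix \<mu> d
      have "\<rho> r ^ d * (\<rho> j ^ \<mu> * omega n (w j) m) \<le> \<rho> j ^ (\<mu> + d) * omega n (w j) m"
        if j: "j \<in> {1..r}" for j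
      proof -
        have "0 < \<rho> j" "0 < \<rho> r" "\<rho> r \<le> \<rho> j"
          using j pos Suc.prems Suc.hyps dec[of j r] by (auto simp: le_less)
        then have "\<rho> r ^ d * (\<rho> j ^ \<mu> * omega n (w j) m) \<le> \<rho> j ^ d * (\<rho> j ^ \<mu> * omega n (w j) m)"
          using omega_nonneg[OF n] by (intro mult_right_mono power_mono) auto
        then show ?thesis by (simp add: power_add mult_ac)
      qed
      then show "\<rho> r ^ d * X \<mu> \<le> X (\<mu> + d)"
        unfolding X_def sum_distrib_left by (rule sum_mono)
      show "Y (\<mu> + d) \<le> \<rho> (Suc r) ^ d * Y \<mu>" by (simp add: Y_def power_add)
      have "0 \<le> \<rho> j" if "j \<in> {1..Suc r}" for j using pos[of j] that Suc.prems by auto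
      then show "0 \<le> X \<mu>" "0 \<le> Y \<mu>"
        unfolding X_def Y_def using omega_nonneg[OF n] by (auto intro!: sum_nonneg)
      show "omega n u \<mu> \<le> omega n (u + w (Suc r)) \<mu> + omega n (w (Suc r)) \<mu>"
        using omega_add_le[OF n, of "u + w (Suc r)" "- w (Suc r)" \<mu>]
        unfolding omega_uminus add_uminus_conv_diff add_diff_cancel_right' .
      show "omega n (w (Suc r)) \<mu> \<le> omega n (u + w (Suc r)) \<mu> + omega n u \<mu>"
        using omega_add_le[OF n, of "u + w (Suc r)" "- u" \<mu>]
        unfolding omega_uminus add_uminus_conv_diff add_diff_cancel_left' .
      show "0 \<le> omega n (u + w (Suc r)) \<mu>" by (rule omega_nonneg[OF n])
    qed (rule \<nu>)
    moreover have "(\<Sum>j=1..Suc r. \<rho> j ^ \<nu> * omega n (w j) m) = X \<nu> + Y \<nu>"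
      unfolding X_def Y_def using Suc.hyps by simp
    ultimately show "(\<Sum>j=1..Suc r. \<rho> j ^ \<nu> * omega n (w j) m)
        \<le> exp (D * growth_exponent k \<nu>) * omega n (\<Sum>j=1..Suc r. w j) \<nu>"
      unfolding all by (simp only:)
  qed (use D N N' in auto)
qed

text \<open>
  For \<open>\<nu> < N\<close> the bound at \<open>N\<close> is transported back by the crude growth. The finitely many steps cost a
  constant, and a constant can be put into \<open>A'\<close> because the growth exponent is at least \<open>1\<close>.
\<close>

lemma lower_bound_from_eventual:
  assumes n: "n \<ge> 1" and m: "m \<ge> 1" and k: "k \<ge> 1" and B: "B \<ge> 0" and C: "C \<ge> 1"
    and \<rho>: "\<rho> > 0" and N: "N \<ge> m"
    and growth: "\<And>y \<nu>. y \<in> V \<Longrightarrow> \<nu> \<ge> m \<Longrightarrow> omega n y (Suc \<nu>) \<le> C * omega n y \<nu>"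
    and ev: "\<And>y \<nu>. y \<in> V \<Longrightarrow> \<nu> \<ge> N \<Longrightarrow>
      \<rho> ^ \<nu> * omega n y m \<le> exp (B * growth_exponent k \<nu>) * omega n y \<nu>"
  shows "\<exists>A'>0. \<forall>y\<in>V. \<forall>\<nu>\<ge>m.
    exp (- A' * growth_exponent k \<nu>) * \<rho> ^ \<nu> * omega n y m \<le> omega n y \<nu>"
proof -
  define q where "q = max 1 (C / \<rho>)"
  define E where "E = B * growth_exponent k N + real N * ln q"
  define A' where "A' = B + E + 1"
  have gN: "growth_exponent k N \<ge> 1" using growth_exponent_ge_1 k m N by simp
  have q: "q \<ge> 1" by (simp add: q_def)
  have E: "E \<ge> 0" unfolding E_def using B gN q by simp
  have main: "\<rho> ^ \<nu> * omega n y m \<le> exp (A' * growth_exponent k \<nu>) * omega n y \<nu>"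
    if y: "y \<in> V" and \<nu>: "\<nu> \<ge> m" for y \<nu>
  proof -
    have g: "growth_exponent k \<nu> \<ge> 1" using growth_exponent_ge_1 k m \<nu> by simp
    have om: "omega n y \<nu> \<ge> 0" by (rule omega_nonneg[OF n])
    show ?thesis
    proof (cases "\<nu> \<ge> N")
      case True
      have "B * growth_exponent k \<nu> \<le> A' * growth_exponent k \<nu>"
        using g E by (intro mult_right_mono) (auto simp: A'_def)
      then have "exp (B * growth_exponent k \<nu>) * omega n y \<nu> \<le> exp (A' * growth_exponent k \<nu>) * omega n y \<nu>"
        using om by (intro mult_right_mono) auto
      then show ?thesis using ev[OF y True] by linarith
    next
      case False
      define d where "d = N - \<nu>"
      have d: "\<nu> + d = N" "d \<le> N" using False by (auto simp: d_def)
      have "\<rho> ^ d * (\<rho> ^ \<nu> * omega n y m) = \<rho> ^ N * omega n y m"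
        using d(1) by (simp flip: power_add add: mult_ac)
      also have "\<dots> \<le> exp (B * growth_exponent k N) * omega n y N" by (rule ev[OF y order.refl])
      also have "\<dots> \<le> exp (B * growth_exponent k N) * (C ^ d * omega n y \<nu>)"
        using iterate_crude_growth[of C m "omega n y" \<nu> d] growth[OF y] C \<nu> d(1)
        by (intro mult_left_mono) auto
      also have "\<dots> \<le> exp (B * growth_exponent k N) * ((q * \<rho>) ^ d * omega n y \<nu>)"
      proof -
        have "C / \<rho> \<le> q" by (simp add: q_def)
        then have "C \<le> q * \<rho>" using \<rho> by (simp add: field_simps)
        then show ?thesis using C om by (intro mult_left_mono mult_right_mono power_mono) auto
      qed
      also have "\<dots> = \<rho> ^ d * (exp (B * growth_exponent k N) * q ^ d * omega n y \<nu>)"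
        by (simp add: power_mult_distrib)
      finally have "\<rho> ^ \<nu> * omega n y m \<le> exp (B * growth_exponent k N) * q ^ d * omega n y \<nu>"
        using \<rho> by simp
      also have "\<dots> \<le> exp (B * growth_exponent k N) * q ^ N * omega n y \<nu>"
        using q d om by (intro mult_right_mono mult_left_mono power_increasing) auto
      also have "\<dots> = exp E * omega n y \<nu>"
        using q by (simp add: E_def exp_add exp_of_nat_mult)
      also have "\<dots> \<le> exp (A' * growth_exponent k \<nu>) * omega n y \<nu>"
      proof -
        have "E * 1 \<le> A' * growth_exponent k \<nu>"
          using g E B by (intro mult_mono) (auto simp: A'_def)
        then show ?thesis using om by (intro mult_right_mono) auto
      qed
      finally show ?thesis .
    qed
  qed
  have "exp (- A' * growth_exponent k \<nu>) * \<rho> ^ \<nu> * omega n y m \<le> omega n y \<nu>"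
    if "y \<in> V" "\<nu> \<ge> m" for y \<nu>
    using main[OF that] by (simp add: exp_minus field_simps)
  moreover have "A' > 0" using B E by (simp add: A'_def)
  ultimately show ?thesis by blast
qed

section \<open>Multiplicities and the rate zero\<close>

text \<open>
  A nonzero sum of multiplicities also rules out an infinite set of roots, over which the sum would
  be \<open>0\<close> by convention.
\<close>

lemma multiplicity_max_pos:
  assumes "multiplicity_sum p r > 0"
  shows "multiplicity_max p r \<ge> 1"
proof -
  have fin: "finite (roots_of_modulus p r)"
    using assms by (rule contrapos_pp) (simp add: multiplicity_sum_def)
  obtain z where z: "z \<in> roots_of_modulus p r" "order z p > 0"
    using assms unfolding multiplicity_sum_def by (metis gr0I less_irrefl sum.neutral)
  have "order z p \<le> multiplicity_max p r"
    unfolding multiplicity_max_def using fin z by (intro Max_ge) auto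
  then show ?thesis using z by simp
qed

text \<open>
  The summand belonging to the root \<open>0\<close> has no positive rate; this shows that it decays faster than
  any geometric sequence, so that any \<open>\<sigma> > 0\<close> may serve as its rate.
\<close>

lemma superexponential_decay:
  fixes A \<sigma> :: real
  assumes "A > 0" and "\<sigma> > 0" and "k \<ge> 1"
  shows "\<forall>\<^sub>F \<nu> in sequentially. (A / real \<nu>) powr (real \<nu> / real k) \<le> \<sigma> ^ \<nu>"
proof -
  obtain N :: nat where N: "real N > A / \<sigma> ^ k" using reals_Archimedean2 by blast
  show ?thesis
    using eventually_ge_at_top[of "max 1 N"]
  proof eventually_elim
    case (elim \<nu>)
    have "A / \<sigma> ^ k \<le> real \<nu>" using N elim by linarith
    then have "A / real \<nu> \<le> \<sigma> ^ k" using assms elim by (simp add: field_simps)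
    then have "(A / real \<nu>) powr (real \<nu> / real k) \<le> (\<sigma> ^ k) powr (real \<nu> / real k)"
      using assms by (intro powr_mono2) auto
    also have "\<dots> = \<sigma> powr real \<nu>"
      using assms by (simp add: powr_powr flip: powr_realpow)
    also have "\<dots> = \<sigma> ^ \<nu>" using assms by (simp add: powr_realpow)
    finally show ?case .
  qed
qed

lemma coefficients_bounded:
  fixes a :: "nat \<Rightarrow> nat \<Rightarrow> complex"
  assumes "\<And>i. i \<le> n \<Longrightarrow> (\<lambda>\<nu>. a i \<nu> - a_lim i) \<in> O(\<lambda>\<nu>. 1 / (of_nat \<nu> + 1))"
  obtains b where "\<And>i \<nu>. i < n \<Longrightarrow> cmod (a i \<nu>) \<le> b"
proof -
  have "\<exists>K. \<forall>\<nu>. cmod (a i \<nu>) \<le> K" if "i < n" for i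
  proof -
    obtain c where c: "c > 0"
      "\<forall>\<^sub>F \<nu> in sequentially. cmod (a i \<nu> - a_lim i) \<le> c * cmod (1 / (of_nat \<nu> + 1))"
      using assms[of i] \<open>i < n\<close> by (auto elim: landau_o.bigE)
    have "\<forall>\<^sub>F \<nu> in sequentially. cmod (a i \<nu>) \<le> norm (c + cmod (a_lim i))"
      using c(2)
    proof eventually_elim
      case (elim \<nu>)
      have "cmod (of_nat \<nu> + 1) = real \<nu> + 1" using norm_of_nat[of "Suc \<nu>", where 'a = complex] by (simp add: add.commute)
      then have "cmod (1 / (of_nat \<nu> + 1)) \<le> 1" by (simp add: norm_divide)
      then have "c * cmod (1 / (of_nat \<nu> + 1)) \<le> c * 1" using c(1) by (intro mult_left_mono) auto
      then have "cmod (a i \<nu> - a_lim i) \<le> c" using elim by simp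
      then show ?case
        using norm_triangle_ineq[of "a i \<nu> - a_lim i" "a_lim i"] c(1) by simp
    qed
    then have "Bseq (a i)" by (rule Bseq_eventually_mono) simp
    then show ?thesis by (auto simp: Bseq_def)
  qed
  then obtain K where K: "\<And>i \<nu>. i < n \<Longrightarrow> cmod (a i \<nu>) \<le> K i" by metis
  have "cmod (a i \<nu>) \<le> (\<Sum>i<n. K i)" if "i < n" for i \<nu>
  proof -
    have "0 \<le> K j" if "j < n" for j using order_trans[OF norm_ge_zero K[OF that]] .
    then have "K i \<le> (\<Sum>i<n. K i)" using that by (intro member_le_sum) auto
    then show ?thesis using K[OF that, of \<nu>] by linarith
  qed
  then show thesis by (rule that)
qed

section \<open>Solution spaces transversal to a tail space\<close>

theorem theorem10:
  fixes s n m :: nat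
    and a_lim :: "nat \<Rightarrow> complex"
    and a :: "nat \<Rightarrow> nat \<Rightarrow> complex"
    and T :: "complex poly"
    and \<rho> :: "nat \<Rightarrow> real"
    and e k :: "nat \<Rightarrow> nat"
    and A :: real
    and \<alpha> :: "nat \<Rightarrow> real"
    and W :: "nat \<Rightarrow> (nat \<Rightarrow> complex) set"
    and \<theta> :: nat
    and V :: "(nat \<Rightarrow> complex) set"
  assumes n_pos: "n \<ge> 1"
    and leading: "\<And>\<nu>. a n \<nu> = 1"
    and coeff_limit: "\<And>i. i \<le> n \<Longrightarrow> (\<lambda>\<nu>. a i \<nu> - a_lim i) \<in> O(\<lambda>\<nu>. 1 / (of_nat \<nu> + 1))"
    and T_eq: "T = characteristic_polynomial n a_lim"
    and rho_decreasing: "\<And>i. 1 \<le> i \<Longrightarrow> i \<le> s \<Longrightarrow> \<rho> i > \<rho> (i + 1)"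
    and rho_last: "\<rho> (s + 1) = 0"
    and root_moduli: "\<And>z. poly T z = 0 \<Longrightarrow> cmod z \<in> \<rho> ` {1..s+1}"
    and e_eq: "e = (\<lambda>i. multiplicity_sum T (\<rho> i))"
    and k_eq: "k = (\<lambda>i. multiplicity_max T (\<rho> i))"
    and e_pos: "\<And>i. 1 \<le> i \<Longrightarrow> i \<le> s \<Longrightarrow> e i > 0"
    and A_pos: "A > 0"
    and m_pos: "m \<ge> 1"
    and alpha_pos: "\<And>\<nu>. \<nu> \<ge> m \<Longrightarrow> \<alpha> \<nu> > 0"
    and alpha_lim: "\<alpha> \<longlonglongrightarrow> 0"
    and decomposition: "is_direct_sum (solution_space n a m) {1..s+1} W"
    and dim_W: "\<And>i. i \<in> {1..s+1} \<Longrightarrow> seq.dim (W i) = e i"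
    and lower_W: "\<And>j y \<nu>. j \<in> {1..s} \<Longrightarrow> y \<in> W j \<Longrightarrow> \<nu> \<ge> m \<Longrightarrow>
        exp (- A * growth_exponent (k j) \<nu>) * \<rho> j ^ \<nu> * omega n y m \<le> omega n y \<nu>"
    and upper_tail: "\<And>j y \<nu>. j \<in> {1..s} \<Longrightarrow> y \<in> tail_space s W j \<Longrightarrow> \<nu> \<ge> m \<Longrightarrow>
        omega n y \<nu> \<le> exp (A * growth_exponent (k j) \<nu>) * \<rho> j ^ \<nu> * omega n y m"
    and lower_tail: "\<And>j y \<nu>. j \<in> {1..s} \<Longrightarrow> y \<in> tail_space s W j \<Longrightarrow> \<nu> \<ge> m \<Longrightarrow>
        (omega n (tail_projection s W j y) m - \<alpha> \<nu> * omega n y m) * \<rho> j ^ \<nu>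
          * exp (- A * growth_exponent (k j) \<nu>) \<le> omega n y \<nu>"
    and upper_last: "\<And>y \<nu>. k (s + 1) > 0 \<Longrightarrow> y \<in> W (s + 1) \<Longrightarrow> \<nu> \<ge> m \<Longrightarrow>
        cmod (y \<nu>) \<le> (A / real \<nu>) powr (real \<nu> / real (k (s + 1))) * omega n y m"
    and theta: "\<theta> \<in> {1..s}"
    and V_subspace: "seq.subspace V"
    and V_subset: "V \<subseteq> solution_space n a m"
    and V_trivial: "V \<inter> tail_space s W (\<theta> + 1) = {0}"
  shows "\<exists>A'>0. \<forall>y\<in>V. \<forall>\<nu>\<ge>m.
    exp (- A' * growth_exponent (Max (k ` {1..s})) \<nu>) * \<rho> \<theta> ^ \<nu> * omega n y m \<le> omega n y \<nu>"
proof -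
  define Sol where "Sol = solution_space n a m"
  define kk where "kk = Max (k ` {1..s})"
  have \<theta>: "1 \<le> \<theta>" "\<theta> \<le> s" using theta by auto
  have A0: "A \<ge> 0" using A_pos by simp
  have rho_strict: "\<rho> j < \<rho> i" if "1 \<le> i" "i < j" "j \<le> s + 1" for i j
    using that(2,3)
  proof (induction j)
    case (Suc j)
    then have "\<rho> (Suc j) < \<rho> j" using rho_decreasing[of j] that(1) by simp
    then show ?case using Suc by (cases "i = j") auto
  qed simp
  have rho_pos: "\<rho> j > 0" if "1 \<le> j" "j \<le> s" for j
    using rho_strict[of j "s + 1"] rho_last that by simp
  have k_pos: "k j \<ge> 1" if "1 \<le> j" "j \<le> s" for j
    using multiplicity_max_pos e_pos[OF that] by (simp add: e_eq k_eq)
  have k_le: "k j \<le> kk" if "1 \<le> j" "j \<le> s" for j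
    unfolding kk_def using that by (intro Max_ge) auto
  have kk: "kk \<ge> 1" using k_pos[OF \<theta>] k_le[OF \<theta>] by simp
  have g_le: "growth_exponent (k j) \<nu> \<le> growth_exponent kk \<nu>" if "1 \<le> j" "j \<le> s" "\<nu> \<ge> m" for j \<nu>
    using that k_pos k_le m_pos by (intro growth_exponent_mono_index) auto
  have W_sub: "seq.subspace (W j)" if "j \<in> {1..s+1}" for j
    using decomposition that by (simp add: is_direct_sum_def)
  have Sol: "seq.subspace Sol" unfolding Sol_def by (rule subspace_solution_space)
  have W_Sol: "W j \<subseteq> Sol" if "j \<in> {1..s+1}" for j
    using summand_subset_sum_of_spaces[OF _ W_sub that] decomposition
    by (simp add: Sol_def is_direct_sum_def)
  have W_tail: "W j \<subseteq> tail_space s W j" if "j \<in> {1..s+1}" for j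
    unfolding tail_space_def using that by (intro summand_subset_sum_of_spaces W_sub) auto

  obtain b where b: "\<And>i \<nu>. i < n \<Longrightarrow> cmod (a i \<nu>) \<le> b"
    using coefficients_bounded[of n a a_lim, OF coeff_limit] by blast
  define C where "C = max 1 (real n * b)"
  have C: "C \<ge> 1" by (simp add: C_def)
  have growth: "omega n y (Suc \<nu>) \<le> C * omega n y \<nu>" if "y \<in> Sol" "\<nu> \<ge> m" for y \<nu>
    unfolding C_def using that b by (intro solution_crude_growth[where a = a and n = n, OF n_pos leading]) (auto simp: Sol_def)

  have upper: "omega n y \<nu> \<le> exp (A * growth_exponent kk \<nu>) * (\<rho> j ^ \<nu> * omega n y m)"
    if "1 \<le> j" "j \<le> s" "y \<in> tail_space s W j" "\<nu> \<ge> m" for j y \<nu>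
  proof -
    have "omega n y \<nu> \<le> exp (A * growth_exponent (k j) \<nu>) * (\<rho> j ^ \<nu> * omega n y m)"
      using upper_tail[of j y \<nu>] that by (simp add: mult.assoc)
    also have "\<dots> \<le> exp (A * growth_exponent kk \<nu>) * (\<rho> j ^ \<nu> * omega n y m)"
      using that rho_pos[of j] A0 omega_nonneg[OF n_pos] g_le
      by (intro mult_right_mono mult_nonneg_nonneg) (auto intro: mult_left_mono)
    finally show ?thesis .
  qed
  have lower: "\<rho> j ^ \<nu> * omega n y m \<le> exp (A * growth_exponent kk \<nu>) * omega n y \<nu>"
    if "1 \<le> j" "j \<le> s" "y \<in> W j" "\<nu> \<ge> m" for j y \<nu>
  proof -
    have "exp (- A * growth_exponent (k j) \<nu>) * \<rho> j ^ \<nu> * omega n y m \<le> omega n y \<nu>"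
      using lower_W[of j y \<nu>] that by simp
    then have "\<rho> j ^ \<nu> * omega n y m \<le> exp (A * growth_exponent (k j) \<nu>) * omega n y \<nu>"
      by (simp add: exp_minus field_simps)
    also have "\<dots> \<le> exp (A * growth_exponent kk \<nu>) * omega n y \<nu>"
      using that A0 omega_nonneg[OF n_pos] g_le by (intro mult_right_mono) (auto intro: mult_left_mono)
    finally show ?thesis .
  qed

  have "\<exists>B\<ge>0. \<exists>N\<ge>m. \<forall>w. (\<forall>j\<in>{1..\<theta>}. w j \<in> W j) \<longrightarrow> (\<forall>\<nu>\<ge>N.
      (\<Sum>j=1..\<theta>. \<rho> j ^ \<nu> * omega n (w j) m)
        \<le> exp (B * growth_exponent kk \<nu>) * omega n (\<Sum>j=1..\<theta>. w j) \<nu>)"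
  proof (rule component_sum_lower_bound[OF n_pos m_pos kk A0 C Sol, where \<theta> = \<theta>])
    show "omega n y \<nu> \<le> exp (A * growth_exponent kk \<nu>) * (\<rho> j ^ \<nu> * omega n y m)"
      if "1 \<le> j" "j \<le> \<theta>" "y \<in> W j" "m \<le> \<nu>" for j y \<nu>
      using that \<theta> W_tail[of j] by (intro upper) auto
  qed (use \<theta> W_Sol rho_pos rho_strict growth lower in auto)
  then obtain B N1 where B: "B \<ge> 0" and N1: "N1 \<ge> m" and
    components: "\<And>w \<nu>. (\<forall>j\<in>{1..\<theta>}. w j \<in> W j) \<Longrightarrow> \<nu> \<ge> N1 \<Longrightarrow>
      (\<Sum>j=1..\<theta>. \<rho> j ^ \<nu> * omega n (w j) m)
        \<le> exp (B * growth_exponent kk \<nu>) * omega n (\<Sum>j=1..\<theta>. w j) \<nu>"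
    by blast

  \<comment> \<open>The tail has a rate below \<open>\<rho> \<theta>\<close>: the next one if there is one, and otherwise any
    positive number, since then only the root \<open>0\<close> is left.\<close>
  obtain \<sigma> N2 where \<sigma>: "0 < \<sigma>" "\<sigma> < \<rho> \<theta>" and
    tail_decay: "\<And>t \<nu>. t \<in> tail_space s W (\<theta> + 1) \<Longrightarrow> \<nu> \<ge> max m N2 \<Longrightarrow>
      omega n t \<nu> \<le> exp (A * growth_exponent kk \<nu>) * (\<sigma> ^ \<nu> * omega n t m)"
  proof (cases "\<theta> = s")
    case False
    then have "\<theta> + 1 \<le> s" using \<theta> by simp
    then show thesis
      using upper[of "\<theta> + 1"] rho_pos rho_strict \<theta> by (intro that[of "\<rho> (\<theta> + 1)" m]) auto
  next
    case True
    have tail: "tail_space s W (\<theta> + 1) = W (s + 1)"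
      unfolding tail_space_def sum_of_spaces_def True by auto
    \<comment> \<open>With \<open>\<sigma> \<le> 1\<close> the power \<open>\<sigma> ^ \<nu>\<close> bounds \<open>\<sigma> ^ (\<nu> + i)\<close> throughout the window.\<close>
    define \<sigma> where "\<sigma> = min 1 (\<rho> \<theta> / 2)"
    have \<sigma>: "0 < \<sigma>" "\<sigma> \<le> 1" "\<sigma> < \<rho> \<theta>" using rho_pos[OF \<theta>] by (auto simp: \<sigma>_def)
    have "\<exists>N. \<forall>t\<in>W (s + 1). \<forall>\<nu>\<ge>max m N. omega n t \<nu> \<le> \<sigma> ^ \<nu> * omega n t m"
    proof (cases "k (s + 1) > 0")
      case True
      then obtain N where N: "\<And>\<nu>. \<nu> \<ge> N \<Longrightarrow> (A / real \<nu>) powr (real \<nu> / real (k (s + 1))) \<le> \<sigma> ^ \<nu>"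
        using superexponential_decay[OF A_pos \<sigma>(1), of "k (s + 1)"]
        unfolding eventually_sequentially by auto
      have "omega n t \<nu> \<le> \<sigma> ^ \<nu> * omega n t m" if t: "t \<in> W (s + 1)" and \<nu>: "\<nu> \<ge> max m N" for t \<nu>
      proof (rule omega_le[OF n_pos])
        fix i
        have "cmod (t (\<nu> + i)) \<le> (A / real (\<nu> + i)) powr (real (\<nu> + i) / real (k (s + 1))) * omega n t m"
          using \<nu> by (intro upper_last[OF True t]) auto
        also have "\<dots> \<le> \<sigma> ^ \<nu> * omega n t m"
        proof (rule mult_right_mono[OF _ omega_nonneg[OF n_pos]])
          have "\<sigma> ^ (\<nu> + i) \<le> \<sigma> ^ \<nu>" using \<sigma> by (intro power_decreasing) auto
          then show "(A / real (\<nu> + i)) powr (real (\<nu> + i) / real (k (s + 1))) \<le> \<sigma> ^ \<nu>"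
            using N[of "\<nu> + i"] \<nu> by linarith
        qed
        finally show "cmod (t (\<nu> + i)) \<le> \<sigma> ^ \<nu> * omega n t m" .
      qed
      then show ?thesis by blast
    next
      case False
      then have "e (s + 1) = 0"
        using multiplicity_max_pos[of T "\<rho> (s + 1)"] unfolding e_eq k_eq by linarith
      then have zero: "W (s + 1) = {0}"
        using dim_W[of "s + 1"] W_sub[of "s + 1"] W_Sol[of "s + 1"]
        by (intro subspace_dim_0_eq_zero[where a = a and n = n, OF leading]) (auto simp: Sol_def)
      have "omega n t \<nu> \<le> \<sigma> ^ \<nu> * omega n t m" if "t \<in> W (s + 1)" for t \<nu>
        using that unfolding zero by (simp only: singleton_iff omega_zero[OF n_pos] mult_zero_right order.refl)
      then show ?thesis by blast
    qed
    then obtain N where N: "\<And>t \<nu>. t \<in> W (s + 1) \<Longrightarrow> \<nu> \<ge> max m N \<Longrightarrow>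
      omega n t \<nu> \<le> \<sigma> ^ \<nu> * omega n t m" by blast
    show thesis
    proof (rule that[OF \<sigma>(1,3)])
      fix t \<nu> assume t: "t \<in> tail_space s W (\<theta> + 1)" and \<nu>: "\<nu> \<ge> max m N"
      have "omega n t \<nu> \<le> 1 * (\<sigma> ^ \<nu> * omega n t m)" using N[of t \<nu>] t \<nu> tail by simp
      also have "\<dots> \<le> exp (A * growth_exponent kk \<nu>) * (\<sigma> ^ \<nu> * omega n t m)"
        using \<sigma> omega_nonneg[OF n_pos] A0 growth_exponent_ge_1[OF kk, of \<nu>] m_pos \<nu>
        by (intro mult_right_mono) auto
      finally show "omega n t \<nu> \<le> exp (A * growth_exponent kk \<nu>) * (\<sigma> ^ \<nu> * omega n t m)" .
    qed
  qed

  obtain P where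
    P_W: "\<And>i y. y \<in> Sol \<Longrightarrow> i \<in> {1..s+1} \<Longrightarrow> P i y \<in> W i"
    and P_sum: "\<And>y. y \<in> Sol \<Longrightarrow> y = (\<Sum>i=1..s+1. P i y)"
    and P_add: "\<And>i x y. i \<in> {1..s+1} \<Longrightarrow> x \<in> Sol \<Longrightarrow> y \<in> Sol \<Longrightarrow> P i (x + y) = P i x + P i y"
    and P_scale: "\<And>i c x. i \<in> {1..s+1} \<Longrightarrow> x \<in> Sol \<Longrightarrow> P i (seq_scale c x) = seq_scale c (P i x)"
    using direct_sum_components[OF decomposition] unfolding Sol_def by blast
  define u where "u y = (\<Sum>j=1..\<theta>. P j y)" for y
  define t where "t y = (\<Sum>j=\<theta>+1..s+1. P j y)" for y
  define Q where "Q y = (\<Sum>j=1..\<theta>. omega n (P j y) m)" for y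
  have V_Sol: "V \<subseteq> Sol" using V_subset by (simp add: Sol_def)
  have y_ut: "y = u y + t y" if "y \<in> Sol" for y
  proof -
    have "{1..s+1} = {1..\<theta>} \<union> {\<theta>+1..s+1}" "{1..\<theta>} \<inter> {\<theta>+1..s+1} = {}" using \<theta> by auto
    then have "(\<Sum>i=1..s+1. P i y) = u y + t y"
      unfolding u_def t_def by (simp only: sum.union_disjoint finite_atLeastAtMost)
    then show ?thesis using P_sum[OF that] by (rule trans[rotated])
  qed
  have t_tail: "t y \<in> tail_space s W (\<theta> + 1)" if "y \<in> Sol" for y
    unfolding tail_space_def sum_of_spaces_def t_def using P_W[OF that] by fastforce
  have Q0: "Q y \<ge> 0" for y unfolding Q_def using omega_nonneg[OF n_pos] by (intro sum_nonneg)

  \<comment> \<open>On \<open>V\<close> the tail is controlled by the first \<open>\<theta>\<close> components: if those vanish, then \<open>y\<close> equals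
    its tail, and such a \<open>y \<in> V\<close> is \<open>0\<close>.\<close>
  have "\<exists>K\<ge>0. \<forall>y\<in>V. omega n (t y) m \<le> K * (\<Sum>(j,i)\<in>{1..\<theta>} \<times> {..<n}. cmod (P j y (m + i)))"
  proof -
    have "\<exists>K\<ge>0. \<forall>y\<in>V. omega n (t y) m
        \<le> K * (\<Sum>q\<in>{1..\<theta>} \<times> {..<n}. cmod (P (fst q) y (m + snd q)))"
    proof (rule seminorm_le_separating_functionals[OF _ V_subspace])
      fix y assume y: "y \<in> V" and zero: "\<And>q. q \<in> {1..\<theta>} \<times> {..<n} \<Longrightarrow> P (fst q) y (m + snd q) = 0"
      then have y': "y \<in> Sol" using V_Sol by blast
      have "P j y = 0" if j: "j \<in> {1..\<theta>}" for j
      proof (rule solution_eq_zero[where a = a and n = n, OF leading])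
        show "P j y \<in> solution_space n a m" using P_W[OF y', of j] W_Sol[of j] j \<theta> by (auto simp: Sol_def)
        show "P j y (m + i) = 0" if "i < n" for i using zero[of "(j, i)"] that j by simp
      qed
      then have "u y = 0" unfolding u_def by (intro sum.neutral) blast
      then have "y = t y" using y_ut[OF y'] by (simp only: add_0_left)
      then show "y = 0" using t_tail[OF y'] V_trivial y by auto
    next
      fix x y assume "x \<in> V" "y \<in> V"
      then have xy: "x \<in> Sol" "y \<in> Sol" using V_Sol by auto
      have "t (x + y) = t x + t y"
        unfolding t_def sum.distrib[symmetric] using P_add[OF _ xy] by (intro sum.cong) auto
      then show "omega n (t (x + y)) m \<le> omega n (t x) m + omega n (t y) m"
        using omega_add_le[OF n_pos, of "t x" "t y" m] by (simp only:)
    next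
      fix c x assume "x \<in> V"
      then have x: "x \<in> Sol" using V_Sol by auto
      have "t (seq_scale c x) = seq_scale c (t x)"
        unfolding t_def seq.scale_sum_right using P_scale[OF _ x] by (intro sum.cong) auto
      then show "omega n (t (seq_scale c x)) m \<le> cmod c * omega n (t x) m"
        using omega_scale_le[OF n_pos, of c "t x" m] by (simp only:)
    next
      fix q x y assume q: "q \<in> {1..\<theta>} \<times> {..<n}" and "x \<in> V" "y \<in> V"
      then have xy: "x \<in> Sol" "y \<in> Sol" using V_Sol by auto
      have "fst q \<in> {1..s+1}" using q \<theta> by auto
      from P_add[OF this xy] show "P (fst q) (x + y) (m + snd q)
          = P (fst q) x (m + snd q) + P (fst q) y (m + snd q)"
        by (simp only: plus_fun_apply)
    next
      fix q c x assume q: "q \<in> {1..\<theta>} \<times> {..<n}" and "x \<in> V"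
      then have x: "x \<in> Sol" using V_Sol by auto
      have "fst q \<in> {1..s+1}" using q \<theta> by auto
      from P_scale[OF this x] show "P (fst q) (seq_scale c x) (m + snd q) = c * P (fst q) x (m + snd q)"
        by (simp only: seq_scale_apply)
    qed simp
    then show ?thesis by (simp only: case_prod_unfold)
  qed
  then obtain K where K: "K \<ge> 0" and tail_le: "\<And>y. y \<in> V \<Longrightarrow>
      omega n (t y) m \<le> K * (\<Sum>(j,i)\<in>{1..\<theta>} \<times> {..<n}. cmod (P j y (m + i)))" by blast
  define M where "M = K * real n"
  have M: "M \<ge> 0" using K by (simp add: M_def)
  have t_Q: "omega n (t y) m \<le> M * Q y" if "y \<in> V" for y
  proof -
    have "(\<Sum>(j,i)\<in>{1..\<theta>} \<times> {..<n}. cmod (P j y (m + i))) = (\<Sum>j=1..\<theta>. \<Sum>i<n. cmod (P j y (m + i)))"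
      by (rule sum.cartesian_product[symmetric])
    also have "\<dots> \<le> (\<Sum>j=1..\<theta>. \<Sum>i<n. omega n (P j y) m)"
      by (intro sum_mono omega_ge) simp
    also have "\<dots> = real n * Q y" by (simp add: Q_def sum_distrib_left)
    finally have "K * (\<Sum>(j,i)\<in>{1..\<theta>} \<times> {..<n}. cmod (P j y (m + i))) \<le> K * (real n * Q y)"
      using K by (rule mult_left_mono)
    then show ?thesis using tail_le[OF that] by (simp add: M_def mult.assoc)
  qed
  have y_Q: "omega n y m \<le> (1 + M) * Q y" if "y \<in> V" for y
  proof -
    have y: "y \<in> Sol" using that V_Sol by blast
    have "omega n (u y) m \<le> Q y" unfolding u_def Q_def using n_pos by (intro omega_sum_le) auto
    then have "omega n (u y + t y) m \<le> Q y + M * Q y"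
      using omega_add_le[OF n_pos, of "u y" "t y" m] t_Q[OF that] by linarith
    then show ?thesis using arg_cong[OF y_ut[OF y], of "\<lambda>x. omega n x m"] by (simp add: algebra_simps)
  qed

  \<comment> \<open>Once \<open>exp (D * growth_exponent kk \<nu>)\<close> is absorbed by \<open>(\<rho> \<theta> / \<sigma>) ^ \<nu>\<close>, the tail is at most half
    of the lower bound for \<open>u y\<close>.\<close>
  define D where "D = A + B + 2 * (1 + M)"
  have "\<forall>\<^sub>F \<nu> in sequentially. exp (D * growth_exponent kk \<nu>) * \<sigma> ^ \<nu> \<le> \<rho> \<theta> ^ \<nu>"
    using A0 B M \<sigma> by (intro power_ratio_beats_growth_exponent[OF kk]) (auto simp: D_def)
  then obtain N3 where N3: "\<And>\<nu>. \<nu> \<ge> N3 \<Longrightarrow> exp (D * growth_exponent kk \<nu>) * \<sigma> ^ \<nu> \<le> \<rho> \<theta> ^ \<nu>"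
    unfolding eventually_sequentially by blast
  have exp_const: "x * z \<le> exp ((x + w) * growth_exponent kk \<nu>) * r"
    if "0 \<le> x" "0 \<le> r" "z \<le> exp (w * growth_exponent kk \<nu>) * r" "\<nu> \<ge> m" for x z w r \<nu>
  proof -
    have "x \<le> x * growth_exponent kk \<nu>"
      using mult_left_mono[OF growth_exponent_ge_1[OF kk, of \<nu>] \<open>0 \<le> x\<close>] m_pos \<open>\<nu> \<ge> m\<close> by simp
    also have "\<dots> \<le> exp (x * growth_exponent kk \<nu>)"
      using exp_ge_add_one_self[of "x * growth_exponent kk \<nu>"] by linarith
    finally have "x * (exp (w * growth_exponent kk \<nu>) * r)
        \<le> exp (x * growth_exponent kk \<nu>) * (exp (w * growth_exponent kk \<nu>) * r)"
      using that by (intro mult_right_mono) auto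
    moreover have "x * z \<le> x * (exp (w * growth_exponent kk \<nu>) * r)"
      using that by (intro mult_left_mono)
    ultimately show ?thesis by (simp add: algebra_simps exp_add)
  qed
  have "\<exists>A'>0. \<forall>y\<in>V. \<forall>\<nu>\<ge>m.
    exp (- A' * growth_exponent kk \<nu>) * \<rho> \<theta> ^ \<nu> * omega n y m \<le> omega n y \<nu>"
  proof (rule lower_bound_from_eventual[OF n_pos m_pos kk _ C rho_pos[OF \<theta>]])
    show "0 \<le> 2 * (1 + M) + B" using M B by simp
    show "m \<le> max (max m N1) (max N2 N3)" by simp
    show "omega n y (Suc \<nu>) \<le> C * omega n y \<nu>" if "y \<in> V" "m \<le> \<nu>" for y \<nu>
      using that V_Sol by (intro growth) auto
    fix y \<nu> assume y: "y \<in> V" and \<nu>: "max (max m N1) (max N2 N3) \<le> \<nu>"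
    have y': "y \<in> Sol" using y V_Sol by blast
    let ?g = "growth_exponent kk \<nu>"
    have "\<rho> \<theta> ^ \<nu> * Q y = (\<Sum>j=1..\<theta>. \<rho> \<theta> ^ \<nu> * omega n (P j y) m)"
      unfolding Q_def by (rule sum_distrib_left)
    also have "\<dots> \<le> (\<Sum>j=1..\<theta>. \<rho> j ^ \<nu> * omega n (P j y) m)"
    proof (intro sum_mono mult_right_mono power_mono omega_nonneg[OF n_pos])
      fix j assume "j \<in> {1..\<theta>}"
      then show "\<rho> \<theta> \<le> \<rho> j" using rho_strict[of j \<theta>] \<theta> by (cases "j = \<theta>") auto
    qed (use rho_pos[OF \<theta>] in simp)
    also have "\<dots> \<le> exp (B * ?g) * omega n (u y) \<nu>"
      unfolding u_def using P_W[OF y'] \<theta> \<nu> by (intro components) auto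
    finally have u_ge: "\<rho> \<theta> ^ \<nu> * Q y \<le> exp (B * ?g) * omega n (u y) \<nu>" .

    have t_le: "omega n (t y) \<nu> \<le> exp (A * ?g) * (\<sigma> ^ \<nu> * (M * Q y))"
    proof -
      have "omega n (t y) \<nu> \<le> exp (A * ?g) * (\<sigma> ^ \<nu> * omega n (t y) m)"
        using \<nu> by (intro tail_decay t_tail[OF y']) auto
      also have "\<dots> \<le> exp (A * ?g) * (\<sigma> ^ \<nu> * (M * Q y))"
        using \<sigma> t_Q[OF y] by (intro mult_left_mono) auto
      finally show ?thesis .
    qed
    have "2 * (1 + M) * (exp (B * ?g) * omega n (t y) \<nu>) \<le> \<rho> \<theta> ^ \<nu> * (M * Q y)"
    proof -
      have "exp (B * ?g) * omega n (t y) \<nu> \<le> exp (B * ?g) * (exp (A * ?g) * (\<sigma> ^ \<nu> * (M * Q y)))"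
        using t_le by (intro mult_left_mono) auto
      also have "\<dots> = exp ((A + B) * ?g) * (\<sigma> ^ \<nu> * (M * Q y))"
        by (simp add: exp_add algebra_simps)
      finally have "2 * (1 + M) * (exp (B * ?g) * omega n (t y) \<nu>)
          \<le> exp ((2 * (1 + M) + (A + B)) * ?g) * (\<sigma> ^ \<nu> * (M * Q y))"
        using M \<sigma> Q0 \<nu> by (intro exp_const) auto
      also have "\<dots> = exp (D * ?g) * \<sigma> ^ \<nu> * (M * Q y)" by (simp add: D_def algebra_simps)
      also have "\<dots> \<le> \<rho> \<theta> ^ \<nu> * (M * Q y)"
        using N3[of \<nu>] \<nu> M Q0 by (intro mult_right_mono) auto
      finally show ?thesis .
    qed
    moreover have "\<rho> \<theta> ^ \<nu> * (M * Q y) \<le> (1 + M) * (\<rho> \<theta> ^ \<nu> * Q y)"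
      using rho_pos[OF \<theta>] Q0[of y] by (simp add: algebra_simps)
    ultimately have "(1 + M) * (2 * (exp (B * ?g) * omega n (t y) \<nu>)) \<le> (1 + M) * (\<rho> \<theta> ^ \<nu> * Q y)"
      by (simp add: algebra_simps)
    then have t_half: "2 * (exp (B * ?g) * omega n (t y) \<nu>) \<le> \<rho> \<theta> ^ \<nu> * Q y"
      using M by (subst (asm) mult_le_cancel_left_pos) auto
    have "omega n (u y) \<nu> \<le> omega n y \<nu> + omega n (t y) \<nu>"
    proof -
      have "omega n (u y) \<nu> \<le> omega n (u y + t y) \<nu> + omega n (t y) \<nu>"
        using omega_add_le[OF n_pos, of "u y + t y" "- t y" \<nu>]
        unfolding omega_uminus add_uminus_conv_diff add_diff_cancel_right' .
      then show ?thesis unfolding y_ut[OF y', symmetric] .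
    qed
    then have "exp (B * ?g) * omega n (u y) \<nu> \<le> exp (B * ?g) * (omega n y \<nu> + omega n (t y) \<nu>)"
      by (intro mult_left_mono) auto
    then have Q_le: "\<rho> \<theta> ^ \<nu> * Q y \<le> 2 * (exp (B * ?g) * omega n y \<nu>)"
      using u_ge t_half unfolding distrib_left by linarith
    have "\<rho> \<theta> ^ \<nu> * omega n y m \<le> \<rho> \<theta> ^ \<nu> * ((1 + M) * Q y)"
      using y_Q[OF y] rho_pos[OF \<theta>] by (intro mult_left_mono) auto
    also have "\<dots> = (1 + M) * (\<rho> \<theta> ^ \<nu> * Q y)" by simp
    also have "\<dots> \<le> (1 + M) * (2 * (exp (B * ?g) * omega n y \<nu>))"
      using Q_le M by (intro mult_left_mono) auto
    also have "\<dots> = 2 * (1 + M) * (exp (B * ?g) * omega n y \<nu>)" by simp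
    also have "\<dots> \<le> exp ((2 * (1 + M) + B) * ?g) * omega n y \<nu>"
      using M \<nu> omega_nonneg[OF n_pos] by (intro exp_const) auto
    finally show "\<rho> \<theta> ^ \<nu> * omega n y m \<le> exp ((2 * (1 + M) + B) * ?g) * omega n y \<nu>" .
  qed
  then show ?thesis by (simp only: kk_def)
qed

end
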